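(* Let $0<k\leq n$ be integers, let $\omega_0$ be the standard symplectic form on the space $\mathbb C^{k\times n}$ of complex $k\times n$ matrices, and let $V(k,n):=\{\Theta\in\mathbb C^{k\times n}\mid\Theta\Theta^*=\mathbf 1\}$ be the Stiefel manifold (a coisotropic submanifold of $(\mathbb C^{k\times n},\omega_0)$). Then $A\big(\mathbb C^{k\times n},\omega_0,V(k,n)\big)=\pi$. Furthermore, for every $C>\pi$ there exists $\varphi\in\operatorname{Ham}_{\mathrm c}(\mathbb C^{k\times n},\omega_0)$ such that $d_{\mathrm c}(\varphi,\operatorname{id})<C$ and $\varphi(V(k,n))\cap V(k,n)=\emptyset$.
   Context: For a coisotropic submanifold $N$ of a symplectic manifold $(M,\omega)$ (i.e. $T_xN^\omega:=\{v\in T_xM\mid\omega(v,w)=0\ \forall w\in T_xN\}\subseteq T_xN$ for all $x\in N$), the isotropic leaf through $x\in N$ is $N_x:=\{y(1)\mid y\in C^\infty([0,1],N),\ y(0)=x,\ \dot y(t)\in T_{y(t)}N^\omega\ \forall t\}$, and $N_\omega$ is the set of isotropic leaves. The minimal area is $A(M,\omega,N):=\inf\big(S(M,\omega,N)\cap(0,\infty)\big)$, where $S(M,\omega,N):=\{\int_{\mathbb D}u^*\omega\mid u\in C^\infty(\mathbb D,M),\ \exists F\in N_\omega:\ u(S^1)\subseteq F\}$ and $\mathbb D\subseteq\mathbb R^2$ is the closed unit disk. The form $\omega_0$ on $\mathbb C^{k\times n}\cong\mathbb R^{2kn}$ is $\sum dx\wedge dy$ over the matrix entries $x+iy$. For $H\in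 C^\infty([0,1]\times M,\mathbb R)$, $H_t:=H(t,\cdot)$, the vector field $X_{H_t}$ is given by $dH_t=\omega(X_{H_t},\cdot)$, $\varphi_H^t$ is the time-$t$ flow of $(X_{H_t})$, and $\|H\|:=\int_0^1(\sup_MH_t-\inf_MH_t)\,dt$. $\operatorname{Ham}_{\mathrm c}(M,\omega)$ is the group of diffeomorphisms $\varphi_H^1$ with $H\in C^\infty_{\mathrm c}([0,1]\times M,\mathbb R)$ (compact support), and $d_{\mathrm c}(\varphi,\psi):=\inf\{\|H\|\mid H\in C_{\mathrm c}^\infty([0,1]\times M,\mathbb R),\ \psi^{-1}\circ\varphi=\varphi_H^1\}$ is the compactly supported Hofer distance. *)

theory Defs
  imports "HOL-Analysis.Analysis"
begin

section \<open>Smooth maps and embedded submanifolds\<close>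

text \<open>\<open>Ck_on n f S\<close> is meant for open \<open>S\<close>. Since \<open>frechet_derivative f (at x) v\<close> is required to be
  of class $C^n$ in \<open>x\<close> for every fixed \<open>v\<close>, this is the usual $C^n$ condition in finite dimension.\<close>

primrec Ck_on ::
  "nat \<Rightarrow> ('a::euclidean_space \<Rightarrow> 'b::euclidean_space) \<Rightarrow> 'a set \<Rightarrow> bool" where
  "Ck_on 0 f S \<longleftrightarrow> continuous_on S f"
| "Ck_on (Suc n) f S \<longleftrightarrow>
     (\<forall>x\<in>S. f differentiable (at x)) \<and>
     (\<forall>v. Ck_on n (\<lambda>x. frechet_derivative f (at x) v) S)"

text \<open>Smoothness on an arbitrary set (the closed disk, a closed interval, \<open>{0..1} \<times> UNIV\<close>) means
  that there is a smooth extension to an open neighbourhood.\<close>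

definition smooth_on ::
  "'a set \<Rightarrow> ('a::euclidean_space \<Rightarrow> 'b::euclidean_space) \<Rightarrow> bool" where
  "smooth_on S f \<longleftrightarrow>
     (\<exists>U g. open U \<and> S \<subseteq> U \<and> (\<forall>n. Ck_on n g U) \<and> (\<forall>x\<in>S. g x = f x))"

text \<open>Submanifolds (embedded, without boundary) of a Euclidean space, as local regular level sets.
  The local defining map is a submersion along \<open>N\<close> onto a linear subspace \<open>W\<close>, whose dimension is
  the codimension of \<open>N\<close>; as this never exceeds the ambient dimension, \<open>W\<close> can be taken inside the
  ambient space.\<close>

definition embedded_submanifold :: "'a::euclidean_space set \<Rightarrow> bool" where
  "embedded_submanifold N \<longleftrightarrow>
     (\<forall>x\<in>N. \<exists>U W. \<exists>f::'a \<Rightarrow> 'a.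
        open U \<and> x \<in> U \<and> subspace W \<and> smooth_on U f \<and> f ` U \<subseteq> W \<and>
        N \<inter> U = {y \<in> U. f y = 0} \<and>
        (\<forall>y\<in>N \<inter> U. range (frechet_derivative f (at y)) = W))"

definition tangent_space :: "'a::euclidean_space set \<Rightarrow> 'a \<Rightarrow> 'a set" where
  "tangent_space N x =
     {v. \<exists>(e::real) \<gamma>. 0 < e \<and> smooth_on {-e<..<e} \<gamma> \<and> \<gamma> ` {-e<..<e} \<subseteq> N \<and>
           \<gamma> 0 = x \<and> (\<gamma> has_vector_derivative v) (at 0)}"


section \<open>Coisotropic submanifolds, isotropic leaves and minimal area\<close>

text \<open>The ambient symplectic manifold is a Euclidean space \<open>'a\<close> with a constant symplectic form
  \<open>\<omega>\<close>, so every tangent space is identified with \<open>'a\<close>.\<close>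

definition symplectic_complement ::
  "('a \<Rightarrow> 'a \<Rightarrow> real) \<Rightarrow> 'a set \<Rightarrow> 'a::euclidean_space set" where
  "symplectic_complement \<omega> W = {v. \<forall>w\<in>W. \<omega> v w = 0}"

definition coisotropic_submanifold ::
  "('a \<Rightarrow> 'a \<Rightarrow> real) \<Rightarrow> 'a::euclidean_space set \<Rightarrow> bool" where
  "coisotropic_submanifold \<omega> N \<longleftrightarrow>
     embedded_submanifold N \<and>
     (\<forall>x\<in>N. symplectic_complement \<omega> (tangent_space N x) \<subseteq> tangent_space N x)"

definition isotropic_leaf ::
  "('a \<Rightarrow> 'a \<Rightarrow> real) \<Rightarrow> 'a::euclidean_space set \<Rightarrow> 'a \<Rightarrow> 'a set" where
  "isotropic_leaf \<omega> N x =
     {y 1 | y::real \<Rightarrow> 'a.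
        smooth_on {0..1} y \<and> y ` {0..1} \<subseteq> N \<and> y 0 = x \<and>
        (\<forall>t\<in>{0..1}. vector_derivative y (at t within {0..1})
                       \<in> symplectic_complement \<omega> (tangent_space N (y t)))}"

definition isotropic_leaves ::
  "('a \<Rightarrow> 'a \<Rightarrow> real) \<Rightarrow> 'a::euclidean_space set \<Rightarrow> 'a set set" where
  "isotropic_leaves \<omega> N = isotropic_leaf \<omega> N ` N"

text \<open>The product type \<open>real \<times> real\<close> carries the Euclidean norm, so \<open>unit_disk\<close> is round.\<close>

abbreviation unit_disk :: "(real \<times> real) set" where
  "unit_disk \<equiv> cball (0, 0) 1"

abbreviation unit_circle :: "(real \<times> real) set" where
  "unit_circle \<equiv> sphere (0, 0) 1"

definition symplectic_area ::
  "('a \<Rightarrow> 'a \<Rightarrow> real) \<Rightarrow> (real \<times> real \<Rightarrow> 'a::euclidean_space) \<Rightarrow> real" where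
  "symplectic_area \<omega> u =
     integral unit_disk
       (\<lambda>z. \<omega> (frechet_derivative u (at z within unit_disk) (1, 0))
              (frechet_derivative u (at z within unit_disk) (0, 1)))"

definition area_spectrum ::
  "('a \<Rightarrow> 'a \<Rightarrow> real) \<Rightarrow> 'a::euclidean_space set \<Rightarrow> real set" where
  "area_spectrum \<omega> N =
     {symplectic_area \<omega> u | u.
        smooth_on unit_disk u \<and> (\<exists>F\<in>isotropic_leaves \<omega> N. u ` unit_circle \<subseteq> F)}"

text \<open>Extended reals, so that the infimum of the empty set is \<open>\<infinity>\<close>.\<close>

definition minimal_area ::
  "('a \<Rightarrow> 'a \<Rightarrow> real) \<Rightarrow> 'a::euclidean_space set \<Rightarrow> ereal" where
  "minimal_area \<omega> N = Inf (ereal ` (area_spectrum \<omega> N \<inter> {0<..}))"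


section \<open>Compactly supported Hamiltonian diffeomorphisms and the Hofer distance\<close>

definition compactly_supported_hamiltonians ::
  "(real \<times> 'a::euclidean_space \<Rightarrow> real) set" where
  "compactly_supported_hamiltonians =
     {H. smooth_on ({0..1} \<times> UNIV) H \<and>
         compact (closure {p \<in> {0..1} \<times> UNIV. H p \<noteq> 0})}"

definition hamiltonian_vector_field ::
  "('a \<Rightarrow> 'a \<Rightarrow> real) \<Rightarrow> ('a::euclidean_space \<Rightarrow> real) \<Rightarrow> 'a \<Rightarrow> 'a" where
  "hamiltonian_vector_field \<omega> h x =
     (THE v. \<forall>w. frechet_derivative h (at x) w = \<omega> v w)"

text \<open>Only meaningful for \<open>t \<in> {0..1}\<close> and if all trajectories exist on \<open>{0..1}\<close>, in particular for
  compactly supported \<open>H\<close>.\<close>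

definition hamiltonian_flow ::
  "('a \<Rightarrow> 'a \<Rightarrow> real) \<Rightarrow> (real \<times> 'a::euclidean_space \<Rightarrow> real) \<Rightarrow> real \<Rightarrow> 'a \<Rightarrow> 'a" where
  "hamiltonian_flow \<omega> H t x =
     (THE z. \<exists>y. y 0 = x \<and>
        (\<forall>s\<in>{0..1}. (y has_vector_derivative
            hamiltonian_vector_field \<omega> (\<lambda>p. H (s, p)) (y s)) (at s within {0..1})) \<and>
        z = y t)"

definition hofer_norm :: "(real \<times> 'a::euclidean_space \<Rightarrow> real) \<Rightarrow> real" where
  "hofer_norm H = integral {0..1} (\<lambda>t. (SUP x. H (t, x)) - (INF x. H (t, x)))"

definition Ham_c :: "('a \<Rightarrow> 'a \<Rightarrow> real) \<Rightarrow> ('a::euclidean_space \<Rightarrow> 'a) set" where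
  "Ham_c \<omega> = {hamiltonian_flow \<omega> H 1 | H. H \<in> compactly_supported_hamiltonians}"

definition hofer_dist_c ::
  "('a \<Rightarrow> 'a \<Rightarrow> real) \<Rightarrow> ('a::euclidean_space \<Rightarrow> 'a) \<Rightarrow> ('a \<Rightarrow> 'a) \<Rightarrow> ereal" where
  "hofer_dist_c \<omega> \<phi> \<psi> =
     Inf {ereal (hofer_norm H) | H. H \<in> compactly_supported_hamiltonians \<and>
            inv \<psi> \<circ> \<phi> = hamiltonian_flow \<omega> H 1}"


section \<open>Complex matrices and the Stiefel manifold\<close>

text \<open>\<open>complex ^ 'n ^ 'k\<close> is the space of matrices with \<open>CARD('k)\<close> rows and \<open>CARD('n)\<close> columns.\<close>

definition omega0 :: "complex ^ 'n ^ 'k \<Rightarrow> complex ^ 'n ^ 'k \<Rightarrow> real" where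
  "omega0 v w =
     (\<Sum>i\<in>UNIV. \<Sum>j\<in>UNIV. Re (v $ i $ j) * Im (w $ i $ j) - Im (v $ i $ j) * Re (w $ i $ j))"

definition conj_transpose :: "complex ^ 'n ^ 'k \<Rightarrow> complex ^ 'k ^ 'n" where
  "conj_transpose A = (\<chi> i j. cnj (A $ j $ i))"

definition Stiefel :: "(complex ^ 'n ^ 'k) set" where
  "Stiefel = {\<Theta>. \<Theta> ** conj_transpose \<Theta> = mat 1}"

end

theory Submission
  imports Defs
begin

text \<open>The tangent space of \<open>V(k,n)\<close> at \<open>x\<close> contains \<open>x B\<close> for every skew-Hermitian \<open>B\<close>, and the vectors
  that are \<open>\<omega>\<^sub>0\<close>-orthogonal to all of these are the \<open>A x\<close> with \<open>A\<close> skew-Hermitian. They are tangent, and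
  the isotropic leaves are the orbits of the unitary group acting from the left. For a disk \<open>u\<close> with
  boundary in the leaf of \<open>x\<close> write \<open>u = U x\<close> on the circle, with \<open>U\<close> a loop of unitary matrices; by
  Green's theorem the area of \<open>u\<close> is half the imaginary part of \<open>\<integral> tr (U' U\<^sup>*)\<close>, i.e. \<open>\<pi>\<close> times the
  winding number of \<open>det U\<close>. Multiplying one row of \<open>x\<close> by \<open>z \<in> D\<close> realizes the value \<open>\<pi>\<close>.

  Every entry of a point of \<open>V(k,n)\<close> lies in the unit disk, so it suffices to move one entry by a
  shear of the plane that displaces the disk. The Hamiltonian of the shear is a function of the real
  part of that entry, cut off smoothly.\<close>

section \<open>Calculus of smooth maps\<close>

text \<open>Only two consequences of the orbit description of the leaves are established. Every
  endpoint \<open>p\<close> of a leaf path from \<open>x\<close> satisfies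
  \<open>p ** ct x ** x = p\<close>, which recovers the unitary matrix as \<open>p ** ct x\<close>;
  and explicit rotations of \<open>x\<close> stay in its leaf, which suffices for the disk of area
  pi. Matrix exponentials are replaced by skew-Hermitian \<open>K\<close> with K^3 = -K, whose
  one-parameter groups are trigonometric. Such \<open>K\<close> span all skew-Hermitian matrices
  over the reals, and products of their groups have any prescribed skew-Hermitian velocity at time
  0. Integrality comes from the logarithmic derivative of the determinant: a closed loop forces the
  exponential of the integrated trace to be 1. The cutoff leaves the field of the shear Hamiltonian
  under control only on a large ball. Since the flow is defined by a unique description, every
  competing trajectory has to be shown to remain in that ball.\<close>

lemma Ck_on_cong:
  assumes "open S" "\<And>x. x \<in> S \<Longrightarrow> f x = g x" "Ck_on n f S"
  shows "Ck_on n g S"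
  using assms(2,3)
proof (induction n arbitrary: f g)
  case 0
  then show ?case by (metis Ck_on.simps(1) continuous_on_cong)
next
  case (Suc n)
  have "(f has_derivative frechet_derivative f (at x)) (at x)" if "x \<in> S" for x
    using Suc.prems(2) that by (simp add: frechet_derivative_works)
  then have g: "(g has_derivative frechet_derivative f (at x)) (at x)" if "x \<in> S" for x
    using has_derivative_transform_within_open[OF _ \<open>open S\<close> that] Suc.prems(1) that by blast
  then have "frechet_derivative f (at x) = frechet_derivative g (at x)" if "x \<in> S" for x
    using frechet_derivative_at that by blast
  then have eq: "frechet_derivative f (at x) v = frechet_derivative g (at x) v" if "x \<in> S" for x v
    using that by simp
  have "Ck_on n (\<lambda>x. frechet_derivative f (at x) v) S" for v
    using Suc.prems(2) by simp
  then have "Ck_on n (\<lambda>x. frechet_derivative g (at x) v) S" for v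
    using eq by (rule Suc.IH[of "\<lambda>x. frechet_derivative f (at x) v" for v, rotated])
  moreover have "g differentiable (at x)" if "x \<in> S" for x
    using g[OF that] by (rule differentiableI)
  ultimately show ?case by simp
qed

text \<open>The working rule for all closure properties: any explicit derivative \<open>D\<close>
  may stand in for \<open>frechet_derivative\<close>, because agreement on the open set
  \<open>S\<close> is enough.\<close>

lemma Ck_on_Suc_derivI:
  assumes "\<And>x. x \<in> S \<Longrightarrow> (f has_derivative D x) (at x)" "open S"
    and "\<And>v. Ck_on n (\<lambda>x. D x v) S"
  shows "Ck_on (Suc n) f S"
proof -
  have "Ck_on n (\<lambda>x. frechet_derivative f (at x) v) S" for v
    using fun_cong[OF frechet_derivative_at[OF assms(1)]] assms(2,3)
    by (rule_tac Ck_on_cong[of S "\<lambda>x. D x v"])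
  moreover have "f differentiable (at x)" if "x \<in> S" for x
    using assms(1)[OF that] by (rule differentiableI)
  ultimately show ?thesis by simp
qed

lemma Ck_on_SucD:
  "Ck_on (Suc n) f S \<Longrightarrow> Ck_on n f S"
proof (induction n arbitrary: f)
  case 0
  then show ?case
    by (simp add: continuous_at_imp_continuous_on differentiable_imp_continuous_within)
next
  case (Suc n)
  then show ?case by simp
qed

lemma Ck_on_Suc_differentiable: "Ck_on (Suc n) f S \<Longrightarrow> x \<in> S \<Longrightarrow> f differentiable (at x)"
  by simp

lemma Ck_on_Suc_frechet_derivative:
  "Ck_on (Suc n) f S \<Longrightarrow> Ck_on n (\<lambda>x. frechet_derivative f (at x) v) S"
  by simp

lemma Ck_on_subset: "Ck_on n f S \<Longrightarrow> T \<subseteq> S \<Longrightarrow> Ck_on n f T"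
  by (induction n arbitrary: f) (auto intro: continuous_on_subset)

lemma Ck_on_Un: "open S \<Longrightarrow> open T \<Longrightarrow> Ck_on n f S \<Longrightarrow> Ck_on n f T \<Longrightarrow> Ck_on n f (S \<union> T)"
  by (induction n arbitrary: f) (auto intro: continuous_on_open_Un)

lemma Ck_on_const: "open S \<Longrightarrow> Ck_on n (\<lambda>x. c) S"
proof (induction n arbitrary: c)
  case (Suc n)
  then show ?case
    by (intro Ck_on_Suc_derivI[where D="\<lambda>x v. 0"]) auto
qed auto

lemma Ck_on_linear: "open S \<Longrightarrow> bounded_linear f \<Longrightarrow> Ck_on n f S"
  by (cases n)
    (simp_all del: Ck_on.simps(2)
      add: linear_continuous_on bounded_linear_imp_has_derivative Ck_on_const
        Ck_on_Suc_derivI[where D="\<lambda>x. f"])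

lemma Ck_on_add:
  "open S \<Longrightarrow> Ck_on n f S \<Longrightarrow> Ck_on n g S \<Longrightarrow> Ck_on n (\<lambda>x. f x + g x) S"
proof (induction n arbitrary: f g)
  case (Suc n)
  then show ?case
    by (intro Ck_on_Suc_derivI[where D="\<lambda>x v. frechet_derivative f (at x) v + frechet_derivative g (at x) v"])
      (auto intro!: has_derivative_add simp: frechet_derivative_works)
qed (auto intro: continuous_on_add)

lemma Ck_on_bounded_linear:
  assumes "bounded_linear L" "open S"
  shows "Ck_on n f S \<Longrightarrow> Ck_on n (\<lambda>x. L (f x)) S"
proof (induction n arbitrary: f)
  case 0
  then show ?case using assms by (simp add: bounded_linear.continuous_on)
next
  case (Suc n)
  then show ?case
    by (intro Ck_on_Suc_derivI[where D="\<lambda>x v. L (frechet_derivative f (at x) v)"]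
        bounded_linear.has_derivative[OF assms(1)] assms(2))
      (simp_all add: frechet_derivative_works)
qed

text \<open>One induction with the Leibniz rule serves real products, inner products and matrix
  products alike.\<close>

lemma Ck_on_bilinear:
  assumes "bounded_bilinear B" "open S"
  shows "Ck_on n f S \<Longrightarrow> Ck_on n g S \<Longrightarrow> Ck_on n (\<lambda>x. B (f x) (g x)) S"
proof (induction n arbitrary: f g)
  case 0
  then show ?case using assms by (simp add: bounded_bilinear.continuous_on)
next
  case (Suc n)
  let ?D = "\<lambda>x v. B (f x) (frechet_derivative g (at x) v) + B (frechet_derivative f (at x) v) (g x)"
  have fg: "Ck_on n f S" "Ck_on n g S" using Suc.prems Ck_on_SucD by blast+
  show ?case
  proof (rule Ck_on_Suc_derivI[where D="?D"])
    show "((\<lambda>x. B (f x) (g x)) has_derivative ?D x) (at x)" if "x \<in> S" for x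
      using Suc.prems that
      by (intro bounded_bilinear.FDERIV[OF assms(1)]) (simp_all add: frechet_derivative_works)
    show "Ck_on n (\<lambda>x. ?D x v) S" for v
      using Suc.prems fg by (intro Ck_on_add assms(2) Suc.IH) simp_all
  qed (rule assms(2))
qed

lemma Ck_on_diff:
  "open S \<Longrightarrow> Ck_on n f S \<Longrightarrow> Ck_on n g S \<Longrightarrow> Ck_on n (\<lambda>x. f x - g x) S"
  using Ck_on_add[of S n f "\<lambda>x. - g x"] Ck_on_bounded_linear[of uminus S n g]
  by (simp add: bounded_linear_minus bounded_linear_ident)

lemmas Ck_on_mult = Ck_on_bilinear[OF bounded_bilinear_mult]
lemmas Ck_on_inner = Ck_on_bilinear[OF bounded_bilinear_inner]

lemma Ck_on_real_deriv:
  assumes "open S" "\<And>x. x \<in> S \<Longrightarrow> (f has_vector_derivative f' x) (at x)" "Ck_on n f' S"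
  shows "Ck_on (Suc n) f S"
proof (rule Ck_on_Suc_derivI[where D="\<lambda>x v. v *\<^sub>R f' x"])
  show "Ck_on n (\<lambda>x. v *\<^sub>R f' x) S" for v
    by (rule Ck_on_bounded_linear[OF bounded_linear_scaleR_right assms(1,3)])
qed (use assms in \<open>simp_all add: has_vector_derivative_def\<close>)

text \<open>The induction generalizes over \<open>f\<close> with \<open>g\<close> fixed: the
  derivative of the composite is the derivative of \<open>g\<close> times \<open>?f'\<close>
  composed with the same \<open>g\<close>. As the outer variable is real, the chain rule gives a
  single product.\<close>

lemma Ck_on_compose_real:
  fixes f :: "real \<Rightarrow> real"
  assumes "open S" "open T"
  shows "Ck_on n f T \<Longrightarrow> Ck_on n g S \<Longrightarrow> g ` S \<subseteq> T \<Longrightarrow> Ck_on n (\<lambda>x. f (g x)) S"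
proof (induction n arbitrary: f)
  case 0
  then show ?case by (simp add: continuous_on_compose2[of T f])
next
  case (Suc n)
  let ?f' = "\<lambda>x. frechet_derivative f (at x) 1"
  have f: "(f has_derivative (\<lambda>v. v * ?f' x)) (at x)" if "x \<in> T" for x
  proof -
    have *: "(f has_derivative frechet_derivative f (at x)) (at x)"
      using Suc.prems(1) that by (simp add: frechet_derivative_works)
    have "frechet_derivative f (at x) (v *\<^sub>R 1) = v *\<^sub>R ?f' x" for v
      by (rule linear_scale[OF has_derivative_linear[OF *]])
    then have "frechet_derivative f (at x) = (\<lambda>v. v * ?f' x)"
      unfolding real_scaleR_def mult_1_right by (rule ext)
    with * show ?thesis by simp
  qed
  have f'g: "Ck_on n (\<lambda>x. ?f' (g x)) S"
  proof (rule Suc.IH[OF _ Ck_on_SucD[OF Suc.prems(2)] Suc.prems(3)])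
    show "Ck_on n ?f' T" using Suc.prems(1) by (simp only: Ck_on.simps)
  qed
  show ?case
  proof (rule Ck_on_Suc_derivI[where D="\<lambda>x v. frechet_derivative g (at x) v * ?f' (g x)"])
    fix x assume x: "x \<in> S"
    then have "(g has_derivative frechet_derivative g (at x)) (at x)"
      using Suc.prems(2) by (simp add: frechet_derivative_works)
    moreover have "g x \<in> T" using x Suc.prems(3) by blast
    ultimately show "((\<lambda>x. f (g x)) has_derivative (\<lambda>v. frechet_derivative g (at x) v * ?f' (g x))) (at x)"
      by (rule has_derivative_compose[OF _ f])
  next
    show "Ck_on n (\<lambda>x. frechet_derivative g (at x) v * ?f' (g x)) S" for v
      using Suc.prems(2) by (intro Ck_on_mult assms(1) f'g) simp
  qed (rule assms(1))
qed

lemma smooth_onI: "(\<And>n. Ck_on n f UNIV) \<Longrightarrow> smooth_on S f"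
  unfolding smooth_on_def by (intro exI[of _ UNIV] exI[of _ f]) auto

text \<open>The constant factor \<open>a\<close> makes the family closed under
  differentiation.\<close>

lemma Ck_on_cis: "Ck_on n (\<lambda>t::real. cis (c * t) * a) UNIV"
proof (induction n arbitrary: a)
  case 0
  then show ?case by (auto intro!: continuous_intros)
next
  case (Suc n)
  show ?case
  proof (rule Ck_on_real_deriv[where f'="\<lambda>t. cis (c * t) * (\<i> * of_real c * a)"])
    show "((\<lambda>t. cis (c * t) * a) has_vector_derivative cis (c * x) * (\<i> * of_real c * a)) (at x)" for x
    proof -
      have "((\<lambda>z. exp (\<i> * (of_real c * z)) * a) has_field_derivative
          exp (\<i> * (of_real c * of_real x)) * (\<i> * of_real c * a)) (at (of_real x))"
        by (auto intro!: derivative_eq_intros)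
      from has_vector_derivative_real_field[OF this] show ?thesis
        by (simp add: cis_conv_exp)
    qed
  qed (auto intro: Suc)
qed

text \<open>Arbitrary exponents close the induction; the exponents -1 and 1/2 later supply
  reciprocals and square roots.\<close>

lemma Ck_on_powr: "Ck_on n (\<lambda>x::real. x powr a) {0<..}"
proof (induction n arbitrary: a)
  case 0
  then show ?case by (auto intro!: continuous_intros)
next
  case (Suc n)
  show ?case
    by (rule Ck_on_real_deriv[where f'="\<lambda>x. a * x powr (a - 1)"])
      (auto intro!: Ck_on_mult Ck_on_const Suc derivative_eq_intros
         simp: has_real_derivative_iff_has_vector_derivative[symmetric])
qed

section \<open>A smooth transition function\<close>

text \<open>The flat function exp (-1/x), together with its multiples by powers of 1/x: derivatives
  of members are linear combinations of members. The transition function itself uses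
  \<open>m = 0\<close>.\<close>

definition bump :: "nat \<Rightarrow> real \<Rightarrow> real" where
  "bump m x = (if x \<le> 0 then 0 else exp (- inverse x) * inverse x ^ m)"

lemma bump_DERIV: "(bump m has_real_derivative bump (m+2) x - m * bump (m+1) x) (at x)"
proof -
  consider "x < 0" | "x = 0" | "x > 0" by linarith
  then show ?thesis
  proof cases
    case 1
    have "((\<lambda>x::real. 0) has_real_derivative 0) (at x)" by simp
    then have "(bump m has_real_derivative 0) (at x)"
      by (rule has_field_derivative_transform_within_open[where S="{..<0}"])
        (use 1 in \<open>auto simp: bump_def\<close>)
    then show ?thesis using 1 by (simp add: bump_def)
  next
    case 3
    have "((\<lambda>x. exp (- inverse x) * inverse x ^ m) has_real_derivative
        bump (m+2) x - m * bump (m+1) x) (at x)"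
    proof (cases m)
      case (Suc k)
      show ?thesis
        using 3 Suc
        by (auto intro!: derivative_eq_intros simp: bump_def field_simps power2_eq_square)
          (metis One_nat_def power_eq_if)
    qed (use 3 in \<open>auto intro!: derivative_eq_intros simp: bump_def field_simps power2_eq_square\<close>)
    then show ?thesis
      by (rule has_field_derivative_transform_within_open[where S="{0<..}"])
        (use 3 in \<open>auto simp: bump_def\<close>)
  next
    case 2
    \<comment> \<open>This is the difference quotient at 0. With z = 1/y it becomes z^(m+1) / exp z
      at infinity.\<close>
    have "((\<lambda>y. inverse y * bump m y) \<longlongrightarrow> 0) (at_right 0)"
    proof -
      have "((\<lambda>z::real. z ^ (m+1) / exp z) \<longlongrightarrow> 0) at_top"
        by (rule tendsto_power_div_exp_0)
      then have "((\<lambda>y::real. (inverse y) ^ (m+1) / exp (inverse y)) \<longlongrightarrow> 0) (at_right 0)"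
        by (rule filterlim_compose) (rule filterlim_inverse_at_top_right)
      then show ?thesis
        by (rule filterlim_cong[THEN iffD1, rotated -1])
          (auto simp: eventually_at_filter bump_def exp_minus field_simps)
    qed
    moreover have "((\<lambda>y. inverse y * bump m y) \<longlongrightarrow> 0) (at_left 0)"
      by (rule filterlim_cong[THEN iffD1, OF _ _ _ tendsto_const])
          (auto simp: eventually_at_filter bump_def)
    ultimately have "((\<lambda>y. inverse y * bump m y) \<longlongrightarrow> 0) (at 0)"
      by (simp add: filterlim_at_split)
    then show ?thesis using 2
      by (simp add: has_field_derivative_iff bump_def divide_inverse mult.commute)
  qed
qed

lemma Ck_on_bump: "Ck_on n (bump m) UNIV"
proof (induction n arbitrary: m)
  case 0
  then show ?case using bump_DERIV by (auto intro!: DERIV_continuous_on)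
next
  case (Suc n)
  have "Ck_on n (\<lambda>x. bump (m+2) x + (- real m) * bump (m+1) x) UNIV"
    by (intro Ck_on_add Ck_on_mult Ck_on_const Suc) auto
  then show ?case
    using bump_DERIV[of m]
    by (intro Ck_on_real_deriv[where f'="\<lambda>x. bump (m+2) x + (- real m) * bump (m+1) x"])
      (auto simp: has_real_derivative_iff_has_vector_derivative)
qed

text \<open>The usual quotient of flat functions; the reciprocal is written as a power so that
  \<open>Ck_on_powr\<close> applies.\<close>

definition smooth_step :: "real \<Rightarrow> real" where
  "smooth_step x = bump 0 x * (bump 0 x + bump 0 (1 - x)) powr (-1)"

lemma bump_sum_pos: "bump 0 x + bump 0 (1 - x) > 0"
  by (auto simp: bump_def intro: add_pos_nonneg add_nonneg_pos)

lemma bump_nonneg: "bump m x \<ge> 0"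
  by (auto simp: bump_def)

lemma smooth_step_bounds: "0 \<le> smooth_step x" "smooth_step x \<le> 1"
  using bump_sum_pos[of x] bump_nonneg[of 0 x] bump_nonneg[of 0 "1-x"]
  by (auto simp: smooth_step_def powr_minus field_simps)

lemma smooth_step_eq_0: "x \<le> 0 \<Longrightarrow> smooth_step x = 0"
  by (auto simp: smooth_step_def bump_def)

lemma smooth_step_eq_1: "x \<ge> 1 \<Longrightarrow> smooth_step x = 1"
  using bump_sum_pos[of x]
  by (auto simp: smooth_step_def powr_minus) (simp add: bump_def)

lemma Ck_on_smooth_step: "Ck_on n smooth_step UNIV"
proof -
  have "Ck_on n (\<lambda>x. 1 - x) (UNIV::real set)"
    by (intro Ck_on_diff Ck_on_const Ck_on_linear bounded_linear_ident open_UNIV)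
  then have "Ck_on n (\<lambda>x. bump 0 (1 - x)) UNIV"
    by (rule Ck_on_compose_real[OF open_UNIV open_UNIV Ck_on_bump]) simp
  then have "Ck_on n (\<lambda>x. bump 0 x + bump 0 (1 - x)) UNIV"
    by (intro Ck_on_add Ck_on_bump open_UNIV)
  then have "Ck_on n (\<lambda>x. (bump 0 x + bump 0 (1 - x)) powr (-1)) UNIV"
    using bump_sum_pos by (intro Ck_on_compose_real[OF open_UNIV open_greaterThan Ck_on_powr]) auto
  then show ?thesis
    unfolding smooth_step_def[abs_def] by (intro Ck_on_mult Ck_on_bump open_UNIV)
qed


section \<open>Complex matrices and the symplectic form\<close>

abbreviation "ct \<equiv> conj_transpose"

interpretation matmul: bounded_bilinear "(**) :: complex^'n^'m \<Rightarrow> complex^'p^'n \<Rightarrow> complex^'p^'m"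
  unfolding bilinear_conv_bounded_bilinear[symmetric] bilinear_def
  by (auto intro!: linearI simp: vec_eq_iff matrix_matrix_mult_def sum.distrib algebra_simps
      scaleR_sum_right)

lemma bounded_linear_ct: "bounded_linear (ct :: complex^'n^'k \<Rightarrow> complex^'k^'n)"
  unfolding linear_conv_bounded_linear[symmetric]
  by (auto intro!: linearI simp: vec_eq_iff conj_transpose_def)

lemmas ct_linear = bounded_linear_ct[THEN bounded_linear.linear, THEN linear_add]
  bounded_linear_ct[THEN bounded_linear.linear, THEN linear_diff]
  bounded_linear_ct[THEN bounded_linear.linear, THEN linear_neg]
  bounded_linear_ct[THEN bounded_linear.linear, THEN linear_scale]

lemma ct_mult: "ct (A ** B) = ct B ** ct A"
  by (simp add: vec_eq_iff conj_transpose_def matrix_matrix_mult_def mult.commute)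

lemma ct_ct [simp]: "ct (ct A) = A"
  by (simp add: vec_eq_iff conj_transpose_def)

lemma ct_mat [simp]: "ct (mat c) = mat (cnj c)"
  by (auto simp: vec_eq_iff conj_transpose_def mat_def)

text \<open>Complex scalars act on matrices through \<open>mat c\<close>, while
  \<open>scaleR\<close> is kept for real scalars.\<close>

lemma mat_mult_nth [simp]: "(mat c ** A) $ i $ j = c * A $ i $ j" for A :: "complex^'n^'m"
  by (simp add: matrix_matrix_mult_def mat_def if_distrib[of "\<lambda>x. x * _"] cong: if_cong)

lemma mat_mult_commute: "A ** mat c = mat c ** A" for A :: "complex^'n^'m"
  by (simp add: vec_eq_iff) (simp add: matrix_matrix_mult_def mat_def if_distrib[of "\<lambda>x. _ * x"] mult.commute cong: if_cong)

lemma mat_mat_mult [simp]: "mat c ** (mat d ** A) = mat (c * d) ** A" for A :: "complex^'n^'m"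
  by (simp add: vec_eq_iff)

lemma mult_scale: "A ** (mat c ** B) = mat c ** (A ** B)"
  for A :: "complex^'n^'m" and B :: "complex^'p^'n"
  by (metis mat_mult_commute matrix_mul_assoc)

lemma trace_ct: "trace (ct A) = cnj (trace A)"
  by (simp add: trace_def conj_transpose_def)

lemma trace_scale: "trace (mat c ** A) = c * trace A" for A :: "complex^'n^'n"
  by (simp add: trace_def sum_distrib_left)

lemma scale_mult_scale: "(mat c ** A) ** (mat d ** B) = mat (c * d) ** (A ** B)"
  for A :: "complex^'n^'m" and B :: "complex^'p^'n"
proof -
  have "(mat c ** A) ** (mat d ** B) = mat c ** (A ** mat d) ** B"
    by (simp add: matrix_mul_assoc)
  also have "\<dots> = mat c ** (mat d ** A) ** B"
    by (simp add: mat_mult_commute)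
  finally show ?thesis
    by (simp flip: matrix_mul_assoc)
qed

text \<open>The trace is the squared Frobenius norm. All vanishing arguments for matrices below end
  here.\<close>

lemma trace_mult_ct_eq_0:
  assumes "Re (trace (A ** ct A)) = 0"
  shows "A = 0"
proof -
  have "Re (trace (A ** ct A)) = (\<Sum>i\<in>UNIV. \<Sum>j\<in>UNIV. (cmod (A $ i $ j))\<^sup>2)"
    by (simp add: trace_def matrix_matrix_mult_def conj_transpose_def complex_norm_square[symmetric]
        del: of_real_power)
  with assms have "(cmod (A $ i $ j))\<^sup>2 = 0" for i j
    by (simp add: sum_nonneg_eq_0_iff sum_nonneg)
  then show ?thesis by (simp add: vec_eq_iff)
qed

text \<open>In this form cyclicity of the trace and adjoints replace computations with
  indices.\<close>

lemma omega0_trace: "omega0 v w = Im (trace (w ** ct v))"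
  by (simp add: omega0_def trace_def matrix_matrix_mult_def conj_transpose_def algebra_simps)

interpretation omega0: bounded_bilinear "omega0 :: complex^'n^'k \<Rightarrow> complex^'n^'k \<Rightarrow> real"
  unfolding bilinear_conv_bounded_bilinear[symmetric] bilinear_def
  by (auto intro!: linearI simp: omega0_def sum.distrib algebra_simps sum_distrib_left
      sum_subtractf sum_negf)

lemma omega0_antisym: "omega0 v w = - omega0 w v"
  by (simp add: omega0_def sum_negf[symmetric] algebra_simps)

text \<open>Pairing \<open>v\<close> with i times \<open>v\<close> gives its squared Frobenius
  norm.\<close>

lemma omega0_nondegenerate:
  assumes "\<And>w. omega0 v w = 0"
  shows "v = 0"
proof (rule trace_mult_ct_eq_0)
  show "Re (trace (v ** ct v)) = 0"
    using assms[of "mat \<i> ** v"] by (simp add: omega0_trace trace_scale flip: matrix_mul_assoc)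
qed

definition skew :: "complex^'m^'m \<Rightarrow> bool" where
  "skew A \<longleftrightarrow> ct A = - A"

text \<open>The two signs cancel in the adjoint of \<open>A ** B\<close>, which is
  \<open>B ** A\<close>; by cyclicity the trace equals its own conjugate.\<close>

lemma Im_trace_skew_skew: "skew A \<Longrightarrow> skew B \<Longrightarrow> Im (trace (A ** B)) = 0"
  using trace_ct[of "A ** B"] trace_mul_sym[of A B]
  by (simp add: skew_def ct_mult matmul.minus_left matmul.minus_right complex_eq_iff)

section \<open>Explicit one-parameter groups of unitary matrices\<close>

text \<open>For skew-Hermitian \<open>K\<close> with \<open>K\<^sup>3 = - K\<close> this is the matrix exponential of \<open>t K\<close>.\<close>

definition rot :: "complex^'m^'m \<Rightarrow> real \<Rightarrow> complex^'m^'m" where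
  "rot K t = mat 1 + sin t *\<^sub>R K + (1 - cos t) *\<^sub>R (K ** K)"

text \<open>The cubic equation says that the eigenvalues lie in {0, i, -i}, so powers of
  \<open>K\<close> reduce to \<open>K\<close> and \<open>K ** K\<close> up to sign and the
  exponential series collapses to sine and cosine.\<close>

definition rotation_generator :: "complex^'m^'m \<Rightarrow> bool" where
  "rotation_generator K \<longleftrightarrow> skew K \<and> K ** K ** K = - K"

lemmas matmul_linear = matmul.add_left matmul.add_right matmul.diff_left matmul.diff_right
  matmul.minus_left matmul.minus_right matmul.scaleR_left matmul.scaleR_right

lemma rot_unitary:
  assumes "rotation_generator K"
  shows "rot K t ** ct (rot K t) = mat 1"
proof -
  define s c where "s = sin t" and "c = 1 - cos t"
  have K3: "K ** (K ** K) = - K" "K ** (K ** (K ** K)) = - (K ** K)"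
    using assms by (simp_all add: rotation_generator_def matrix_mul_assoc matmul_linear)
  \<comment> \<open>This is the Pythagorean identity for c = 1 - cos t, and exactly what makes the
    coefficient of \<open>K ** K\<close> vanish below.\<close>
  have sc: "s * s = 2 * c - c * c"
    using sin_cos_squared_add[of t] by (simp add: s_def c_def power2_eq_square algebra_simps)
  have "rot K t ** ct (rot K t) = mat 1 + (2 * c - c * c - s * s) *\<^sub>R (K ** K)"
    using assms
    by (simp add: rot_def ct_mult matmul_linear rotation_generator_def skew_def ct_linear K3 algebra_simps
       flip: s_def c_def matrix_mul_assoc) (simp add: vec_eq_iff complex_eq_iff algebra_simps)
  then show ?thesis using sc by simp
qed

lemma rot_0 [simp]: "rot K 0 = mat 1"
  by (simp add: rot_def)

lemma rot_has_vector_derivative: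
  assumes "rotation_generator K"
  shows "((\<lambda>t. rot K (c * t)) has_vector_derivative (c *\<^sub>R K) ** rot K (c * t)) (at t within S)"
proof -
  have K3: "K ** (K ** K) = - K"
    using assms by (simp add: rotation_generator_def matrix_mul_assoc)
  have eq: "(c *\<^sub>R K) ** rot K (c * t) = (c * cos (c * t)) *\<^sub>R K + (c * sin (c * t)) *\<^sub>R (K ** K)"
    by (simp add: rot_def matmul_linear K3 algebra_simps)
  show ?thesis
    unfolding eq unfolding rot_def
    by (auto intro!: derivative_eq_intros simp: has_vector_derivative_def algebra_simps)
qed

lemma Ck_on_rot: "Ck_on n (\<lambda>t. rot K (c * t)) UNIV"
proof -
  have cis: "Ck_on n (\<lambda>t::real. cis (c * t)) UNIV"
    using Ck_on_cis[of n c 1] by simp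
  have "Ck_on n (\<lambda>t. sin (c * t)) UNIV" "Ck_on n (\<lambda>t. cos (c * t)) UNIV"
    using Ck_on_bounded_linear[OF bounded_linear_Im open_UNIV cis]
      Ck_on_bounded_linear[OF bounded_linear_Re open_UNIV cis] by simp_all
  then show ?thesis
    unfolding rot_def
    by (intro Ck_on_add Ck_on_diff Ck_on_const open_UNIV
        Ck_on_bounded_linear[OF bounded_linear_scaleR_left])
qed

section \<open>Rotation generators span the skew-Hermitian matrices\<close>

definition unit_mat :: "'m \<Rightarrow> 'n \<Rightarrow> complex^'n^'m" where
  "unit_mat a b = (\<chi> c d. if c = a \<and> d = b then 1 else 0)"

lemma unit_mat_mult: "unit_mat a b ** unit_mat c d = (if b = c then unit_mat a d else 0)"
proof -
  have "(\<Sum>k\<in>UNIV. (unit_mat a b $ i $ k) * (unit_mat c d $ k $ j))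
      = (\<Sum>k\<in>UNIV. if k = b then (if i = a \<and> b = c \<and> j = d then 1 else 0) else 0)" for i j
    by (rule sum.cong) (auto simp: unit_mat_def)
  then show ?thesis
    by (auto simp: vec_eq_iff matrix_matrix_mult_def) (auto simp: unit_mat_def)
qed

lemma ct_unit_mat: "ct (unit_mat a b) = unit_mat b a"
  by (auto simp: vec_eq_iff conj_transpose_def unit_mat_def)

definition elementary_skew :: "'m \<Rightarrow> 'm \<Rightarrow> complex \<Rightarrow> complex^'m^'m" where
  "elementary_skew a b z = mat z ** unit_mat a b - mat (cnj z) ** unit_mat b a"

lemma skew_elementary_skew: "skew (elementary_skew a b z)"
  by (simp add: skew_def elementary_skew_def ct_linear ct_mult ct_unit_mat mat_mult_commute)

lemma rotation_generator_elementary_skew: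
  assumes "a \<noteq> b" "cmod z = 1"
  shows "rotation_generator (elementary_skew a b z)"
proof -
  have z: "z * cnj z = 1" "cnj z * z = 1"
    using assms(2) by (simp_all add: complex_norm_square[symmetric] mult.commute)
  let ?K = "elementary_skew a b z"
  have "?K ** ?K = - unit_mat a a - unit_mat b b"
    using assms(1) z
    by (simp add: elementary_skew_def matmul_linear scale_mult_scale unit_mat_mult)
  then have "?K ** ?K ** ?K = - ?K"
    using assms(1)
    by (simp add: elementary_skew_def matmul_linear unit_mat_mult mult_scale)
  then show ?thesis by (simp add: rotation_generator_def skew_elementary_skew)
qed

text \<open>The diagonal needs its own generators: \<open>elementary_skew a a \<i>\<close> is twice
  this matrix, and the factor 2 destroys K^3 = -K.\<close>

definition i_unit :: "'m \<Rightarrow> complex^'m^'m" where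
  "i_unit a = mat \<i> ** unit_mat a a"

lemma rotation_generator_i_unit: "rotation_generator (i_unit a)"
proof -
  have "ct (i_unit a) = - i_unit a"
    by (simp add: i_unit_def ct_mult ct_unit_mat mat_mult_commute) (simp add: vec_eq_iff)
  moreover have "i_unit a ** i_unit a ** i_unit a = - i_unit a"
    by (simp add: i_unit_def scale_mult_scale unit_mat_mult) (simp add: vec_eq_iff)
  ultimately show ?thesis
    by (simp add: rotation_generator_def skew_def)
qed

lemma skew_in_span_rotation_generator:
  assumes "skew A"
  shows "A \<in> span {K. rotation_generator K}"
proof -
  have el: "elementary_skew a b z \<in> span {K. rotation_generator K}" for a b :: 'a and z
  proof -
    \<comment> \<open>The span is over the reals and generators need \<open>z\<close> of modulus 1,
      so \<open>z\<close> is split along 1 and i.\<close>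
    have *: "elementary_skew a b z = Re z *\<^sub>R elementary_skew a b 1 + Im z *\<^sub>R elementary_skew a b \<i>"
      by (simp add: elementary_skew_def vec_eq_iff complex_eq_iff algebra_simps)
    have 1: "elementary_skew a b 1 \<in> span {K. rotation_generator K}"
    proof (cases "a = b")
      case True
      then have "elementary_skew a b 1 = 0" by (auto simp: elementary_skew_def vec_eq_iff)
      then show ?thesis by (simp add: span_zero)
    qed (auto intro!: span_base rotation_generator_elementary_skew)
    have 2: "elementary_skew a b \<i> \<in> span {K. rotation_generator K}"
    proof (cases "a = b")
      case True
      then have "elementary_skew a b \<i> = 2 *\<^sub>R i_unit a"
        by (simp add: elementary_skew_def i_unit_def vec_eq_iff complex_eq_iff)
      also have "\<dots> \<in> span {K. rotation_generator K}"
        by (intro span_scale span_base) (simp add: rotation_generator_i_unit)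
      finally show ?thesis .
    qed (auto intro!: span_base rotation_generator_elementary_skew)
    show ?thesis unfolding * by (intro span_add span_scale 1 2)
  qed
  \<comment> \<open>The double sum without the factor is \<open>A - ct A\<close>, which is twice
    \<open>A\<close>.\<close>
  have "A = (\<Sum>a\<in>UNIV. \<Sum>b\<in>UNIV. (1/2) *\<^sub>R elementary_skew a b (A $ a $ b))"
  proof -
    have "cnj (A $ d $ c) = - A $ c $ d" for c d
      using assms by (simp add: skew_def conj_transpose_def vec_eq_iff)
    moreover have "(\<Sum>a\<in>UNIV. \<Sum>b\<in>UNIV. (1/2) *\<^sub>R elementary_skew a b (A $ a $ b)) $ c $ d
        = (1/2) *\<^sub>R (A $ c $ d - cnj (A $ d $ c))" for c d
    proof -
      have 1: "(\<Sum>a\<in>UNIV. \<Sum>b\<in>UNIV. A $ a $ b * unit_mat a b $ c $ d) = A $ c $ d"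
      proof -
        have "(\<Sum>b\<in>UNIV. A $ a $ b * unit_mat a b $ c $ d) =
            (\<Sum>b\<in>UNIV. if b = d then (if a = c then A $ a $ d else 0) else 0)" for a
          by (rule sum.cong) (auto simp: unit_mat_def)
        then show ?thesis by simp
      qed
      have 2: "(\<Sum>a\<in>UNIV. \<Sum>b\<in>UNIV. cnj (A $ a $ b) * unit_mat b a $ c $ d) = cnj (A $ d $ c)"
      proof -
        have "(\<Sum>b\<in>UNIV. cnj (A $ a $ b) * unit_mat b a $ c $ d) =
            (\<Sum>b\<in>UNIV. if b = c then (if a = d then cnj (A $ a $ c) else 0) else 0)" for a
          by (rule sum.cong) (auto simp: unit_mat_def)
        then show ?thesis by simp
      qed
      have "(\<Sum>a\<in>UNIV. \<Sum>b\<in>UNIV. (1/2) *\<^sub>R elementary_skew a b (A $ a $ b)) $ c $ d =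
          (1/2) *\<^sub>R ((\<Sum>a\<in>UNIV. \<Sum>b\<in>UNIV. A $ a $ b * unit_mat a b $ c $ d)
            - (\<Sum>a\<in>UNIV. \<Sum>b\<in>UNIV. cnj (A $ a $ b) * unit_mat b a $ c $ d))"
        by (simp add: elementary_skew_def sum_subtractf flip: scaleR_sum_right)
      then show ?thesis unfolding 1 2 .
    qed
    ultimately show ?thesis by (simp add: vec_eq_iff scaleR_conv_of_real)
  qed
  also have "\<dots> \<in> span {K. rotation_generator K}"
    by (intro span_sum span_scale el)
  finally show ?thesis .
qed


section \<open>Geometry of the Stiefel manifold\<close>

lemma Stiefel_iff: "x \<in> Stiefel \<longleftrightarrow> x ** ct x = mat 1"
  by (simp add: Stiefel_def)

lemma ct_has_vector_derivative:
  "(f has_vector_derivative f') F \<Longrightarrow> ((\<lambda>t. ct (f t)) has_vector_derivative ct f') F"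
  by (rule bounded_linear.has_vector_derivative[OF bounded_linear_ct])

text \<open>Differentiation of \<open>\<gamma> t ** ct (\<gamma> t) = mat 1\<close> bounds the
  tangent space from above, as needed to test membership in its symplectic complement.\<close>

lemma tangent_space_StiefelD:
  assumes "v \<in> tangent_space Stiefel x"
  shows "v ** ct x + x ** ct v = 0"
proof -
  obtain e :: real and \<gamma> where e: "0 < e" "\<gamma> ` {-e<..<e} \<subseteq> Stiefel" "\<gamma> 0 = x"
    and \<gamma>: "(\<gamma> has_vector_derivative v) (at 0)"
    using assms unfolding tangent_space_def by blast
  have "((\<lambda>t. \<gamma> t ** ct (\<gamma> t)) has_vector_derivative \<gamma> 0 ** ct v + v ** ct (\<gamma> 0)) (at 0)"
    by (intro matmul.has_vector_derivative \<gamma> ct_has_vector_derivative)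
  moreover have "((\<lambda>t. \<gamma> t ** ct (\<gamma> t)) has_vector_derivative 0) (at 0)"
    by (rule has_vector_derivative_transform_within_open[where S="{-e<..<e}" and f="\<lambda>t. mat 1"])
      (use e in \<open>auto simp: Stiefel_iff image_subset_iff\<close>)
  ultimately have "\<gamma> 0 ** ct v + v ** ct (\<gamma> 0) = 0"
    by (rule vector_derivative_unique_at)
  then show ?thesis using e(3) by (simp add: add.commute)
qed

text \<open>For tangent \<open>w\<close> the matrix \<open>w ** ct x\<close> is skew-Hermitian, so
  the pairing is up to sign the imaginary part of the trace of a product of two skew-Hermitian
  matrices.\<close>

lemma skew_mult_in_complement:
  assumes "skew A" "x \<in> Stiefel"
  shows "A ** x \<in> symplectic_complement omega0 (tangent_space Stiefel x)"
  unfolding symplectic_complement_def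
proof (intro CollectI ballI)
  fix w assume "w \<in> tangent_space Stiefel x"
  then have "skew (w ** ct x)"
    using tangent_space_StiefelD[of w x] by (simp add: skew_def ct_mult add_eq_0_iff)
  then have "Im (trace ((w ** ct x) ** A)) = 0"
    using assms(1) by (rule Im_trace_skew_skew)
  moreover have "trace (w ** ct (A ** x)) = - trace ((w ** ct x) ** A)"
    using assms(1) trace_sub[of 0 "(w ** ct x) ** A"]
    by (simp add: ct_mult skew_def matmul_linear matrix_mul_assoc trace_def sum_negf)
  ultimately show "omega0 (A ** x) w = 0"
    by (simp add: omega0_trace)
qed

text \<open>A unitary factor on the right cancels in x times its adjoint. These velocities are the
  test vectors that determine the symplectic complement.\<close>

lemma rot_right_tangent:
  assumes "rotation_generator K" "x \<in> Stiefel"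
  shows "x ** K \<in> tangent_space Stiefel x"
proof -
  have "((\<lambda>t. rot K (1 * t)) has_vector_derivative (1 *\<^sub>R K) ** rot K (1 * 0)) (at 0)"
    by (rule rot_has_vector_derivative[OF assms(1)])
  then have "((\<lambda>t. x ** rot K t) has_vector_derivative x ** K) (at 0)"
    using bounded_linear.has_vector_derivative[OF matmul.bounded_linear_right] by force
  moreover have "smooth_on {-1<..<1} (\<lambda>t. x ** rot K t)"
    using Ck_on_bounded_linear[OF matmul.bounded_linear_right open_UNIV Ck_on_rot[of _ K 1]]
    by (intro smooth_onI) simp
  moreover have "x ** rot K t \<in> Stiefel" for t
  proof -
    have "(x ** rot K t) ** ct (x ** rot K t) = x ** (rot K t ** ct (rot K t)) ** ct x"
      by (simp add: ct_mult matrix_mul_assoc)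
    then show ?thesis using assms by (simp add: Stiefel_iff rot_unitary)
  qed
  ultimately show ?thesis
    unfolding tangent_space_def
    by (intro CollectI exI[of _ 1] exI[of _ "\<lambda>t. x ** rot K t"]) auto
qed

text \<open>Orthogonality to all \<open>x ** B\<close> with \<open>B\<close> skew-Hermitian forces
  \<open>ct v ** x\<close> to be skew-Hermitian; multiplying by \<open>x\<close> on the left then
  solves for \<open>v\<close>.\<close>

lemma complement_tangent_Stiefel:
  assumes v: "v \<in> symplectic_complement omega0 (tangent_space Stiefel x)" and x: "x \<in> Stiefel"
  obtains A where "skew A" "v = A ** x"
proof -
  have orth: "omega0 v (x ** B) = 0" if "skew B" for B
    using skew_in_span_rotation_generator[OF that]
  proof (induction rule: span_induct)
    case base
    show ?case
      by (rule subspaceI) (simp_all add: matmul_linear matmul.zero_right omega0.zero_right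
          omega0.add_right omega0.scaleR_right)
  next
    case (step K)
    then show ?case
      using rot_right_tangent[OF _ x, of K] v by (simp add: symplectic_complement_def)
  qed
  define M where "M = ct v ** x"
  \<comment> \<open>Twice the Hermitian part of \<open>M\<close>. Since i times \<open>N\<close> is
    skew-Hermitian it is an admissible \<open>B\<close>, and the resulting equation says that
    \<open>N\<close> has Frobenius norm 0.\<close>
  define N where "N = M + ct M"
  have ctN: "ct N = N" by (simp add: N_def ct_linear add.commute)
  have "skew (mat \<i> ** N)"
    by (simp add: skew_def ct_mult ctN mat_mult_commute) (simp add: vec_eq_iff)
  from orth[OF this] have "Im (trace ((mat \<i> ** N) ** M)) = 0"
    unfolding omega0_trace M_def
    using trace_mul_sym[of x "(mat \<i> ** N) ** ct v"] by (simp add: matrix_mul_assoc)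
  then have 1: "Re (trace (N ** M)) = 0"
    by (simp add: trace_scale flip: matrix_mul_assoc)
  have "trace (N ** ct M) = cnj (trace (N ** M))"
    using trace_ct[of "N ** M"] trace_mul_sym[of "ct M" N] by (simp add: ct_mult ctN)
  with 1 have "Re (trace (N ** ct M)) = 0" by simp
  with 1 have "Re (trace (N ** ct N)) = 0"
    unfolding ctN by (subst (2) N_def) (simp add: matmul_linear trace_add)
  then have "N = 0" by (rule trace_mult_ct_eq_0)
  then have M: "ct M = - M" by (simp add: N_def add_eq_0_iff)
  have "v = - ((x ** ct v) ** x)"
  proof -
    have "(x ** ct v) ** x = x ** M" by (simp add: M_def matrix_mul_assoc)
    also have "\<dots> = - (x ** ct M)" using M by (simp add: matmul_linear)
    also have "\<dots> = - ((x ** ct x) ** v)" by (simp add: M_def ct_mult matrix_mul_assoc)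
    finally show ?thesis using x by (simp add: Stiefel_iff)
  qed
  moreover have "skew (- (x ** ct v))"
  proof -
    have "x ** ct v = x ** M ** ct x"
      using x by (simp add: M_def Stiefel_iff flip: matrix_mul_assoc)
    moreover have "v ** ct x = x ** ct M ** ct x"
      using x by (simp add: M_def Stiefel_iff ct_mult matrix_mul_assoc)
    ultimately show ?thesis
      using M by (simp add: skew_def ct_mult ct_linear matmul_linear matrix_mul_assoc)
  qed
  ultimately show thesis using that[of "- (x ** ct v)"] by (simp add: matmul_linear)
qed

text \<open>The induction runs along a linear combination of generators: multiplying by one more
  rotation adds its velocity at 0, since both factors are the identity there. The result is a curve,
  in general not a one-parameter group.\<close>

lemma skew_generates_unitary_curve:
  assumes "skew A"
  shows "\<exists>E. (\<forall>n. Ck_on n E UNIV) \<and> (\<forall>t. E t ** ct (E t) = mat 1) \<and> E 0 = mat 1 \<and>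
    (E has_vector_derivative A) (at 0)"
  using skew_in_span_rotation_generator[OF assms]
proof (induction rule: span_induct_alt)
  case base
  show ?case by (rule exI[of _ "\<lambda>t. mat 1"]) (simp add: Ck_on_const)
next
  case (step c K A)
  then obtain E where E: "\<And>n. Ck_on n E UNIV" "\<And>t. E t ** ct (E t) = mat 1" "E 0 = mat 1"
    "(E has_vector_derivative A) (at 0)" by blast
  have K: "rotation_generator K" using step by simp
  let ?F = "\<lambda>t. rot K (c * t) ** E t"
  have "?F t ** ct (?F t) = mat 1" for t
  proof -
    have "?F t ** ct (?F t) = rot K (c * t) ** (E t ** ct (E t)) ** ct (rot K (c * t))"
      by (simp add: ct_mult matrix_mul_assoc)
    then show ?thesis by (simp add: E rot_unitary K)
  qed
  moreover have "Ck_on n ?F UNIV" for n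
    by (rule Ck_on_bilinear[OF matmul.bounded_bilinear_axioms open_UNIV Ck_on_rot E(1)])
  moreover have "(?F has_vector_derivative
      rot K (c * 0) ** A + ((c *\<^sub>R K) ** rot K (c * 0)) ** E 0) (at 0)"
    by (intro matmul.has_vector_derivative E rot_has_vector_derivative K)
  ultimately show ?case
    using E(3) by (intro exI[of _ ?F]) (simp add: add.commute)
qed

lemma skew_mult_in_tangent:
  assumes "skew A" "x \<in> Stiefel"
  shows "A ** x \<in> tangent_space Stiefel x"
proof -
  obtain E where E: "\<And>n. Ck_on n E UNIV" "\<And>t. E t ** ct (E t) = mat 1" "E 0 = mat 1"
    "(E has_vector_derivative A) (at 0)"
    using skew_generates_unitary_curve[OF assms(1)] by blast
  have "E t ** x \<in> Stiefel" for t
  proof -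
    have "(E t ** x) ** ct (E t ** x) = E t ** (x ** ct x) ** ct (E t)"
      by (simp add: ct_mult matrix_mul_assoc)
    then show ?thesis using assms E by (simp add: Stiefel_iff)
  qed
  moreover have "((\<lambda>t. E t ** x) has_vector_derivative A ** x) (at 0)"
    by (rule bounded_linear.has_vector_derivative[OF matmul.bounded_linear_left E(4)])
  moreover have "smooth_on {-1<..<1} (\<lambda>t. E t ** x)"
    by (intro smooth_onI Ck_on_bounded_linear[OF matmul.bounded_linear_left open_UNIV E(1)])
  ultimately show ?thesis
    unfolding tangent_space_def using E(3)
    by (intro CollectI exI[of _ 1] exI[of _ "\<lambda>t. E t ** x"]) auto
qed

text \<open>The natural target of the defining equation is the space of Hermitian matrices. The
  differential is onto it because half of \<open>A ** y\<close> is a preimage of the Hermitian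
  matrix \<open>A\<close>.\<close>

lemma embedded_submanifold_Stiefel: "embedded_submanifold (Stiefel :: (complex^'n^'k) set)"
  unfolding embedded_submanifold_def
proof
  fix x :: "complex^'n^'k" assume "x \<in> Stiefel"
  then have x: "x ** ct x = mat 1" by (simp add: Stiefel_iff)
  define W where "W = (\<lambda>A. A ** x) ` {A. ct A = A}"
  \<comment> \<open>Right multiplication by \<open>x\<close> embeds the square matrices into the ambient space.\<close>
  define f where "f = (\<lambda>y::complex^'n^'k. (y ** ct y - mat 1) ** x)"
  have "Ck_on n f UNIV" for n
    unfolding f_def
    by (intro Ck_on_bounded_linear[OF matmul.bounded_linear_left] open_UNIV Ck_on_diff Ck_on_const
        Ck_on_bilinear[OF matmul.bounded_bilinear_axioms] Ck_on_linear bounded_linear_ct bounded_linear_ident)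
  then have "smooth_on UNIV f" by (rule smooth_onI)
  moreover have "subspace W"
    unfolding W_def
    by (intro linear_subspace_image bounded_linear.linear[OF matmul.bounded_linear_left] subspaceI)
      (auto simp: ct_linear conj_transpose_def vec_eq_iff)
  moreover have "range f \<subseteq> W"
    by (auto simp: W_def f_def ct_linear ct_mult)
  moreover have "f y = 0 \<longleftrightarrow> y \<in> Stiefel" for y
  proof
    assume "f y = 0"
    then have "f y ** ct x = 0" by (simp add: matmul.zero_left)
    then have "y ** ct y - mat 1 = 0" using x by (simp add: f_def flip: matrix_mul_assoc)
    then show "y \<in> Stiefel" by (simp add: Stiefel_iff)
  qed (simp add: Stiefel_iff f_def matmul.zero_left)
  moreover have "range (frechet_derivative f (at y)) = W" if "y \<in> Stiefel" for y
  proof -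
    have "(f has_derivative (\<lambda>v. (y ** ct v + v ** ct y - 0) ** x)) (at y)"
      unfolding f_def
      by (intro bounded_linear.has_derivative[OF matmul.bounded_linear_left] has_derivative_diff
          matmul.FDERIV bounded_linear.has_derivative[OF bounded_linear_ct] has_derivative_const has_derivative_ident)
    then have D: "frechet_derivative f (at y) = (\<lambda>v. (y ** ct v + v ** ct y) ** x)"
      using frechet_derivative_at by force
    have "(\<lambda>v. y ** ct v + v ** ct y) ` UNIV = {A::complex^'k^'k. ct A = A}"
    proof
      show "range (\<lambda>v. y ** ct v + v ** ct y) \<subseteq> {A::complex^'k^'k. ct A = A}"
        by (auto simp: ct_linear ct_mult add.commute)
      show "{A::complex^'k^'k. ct A = A} \<subseteq> range (\<lambda>v. y ** ct v + v ** ct y)"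
      proof
        fix A :: "complex^'k^'k" assume "A \<in> {A. ct A = A}"
        then have A: "ct A = A" by simp
        have y: "y ** ct y = mat 1" using that by (simp add: Stiefel_iff)
        have "(y ** ct y) ** A = A" "A ** (y ** ct y) = A" by (simp_all add: y)
        then have "A = y ** ct ((1/2) *\<^sub>R (A ** y)) + ((1/2) *\<^sub>R (A ** y)) ** ct y"
          by (simp add: ct_linear ct_mult A matmul_linear matrix_mul_assoc flip: scaleR_add_left)
        then show "A \<in> range (\<lambda>v. y ** ct v + v ** ct y)" by blast
      qed
    qed
    moreover have "range (frechet_derivative f (at y)) =
        (\<lambda>A. A ** x) ` range (\<lambda>v. y ** ct v + v ** ct y)"
      unfolding D by (rule image_image[symmetric])
    ultimately show ?thesis by (simp only: W_def)
  qed
  ultimately have "open UNIV \<and> x \<in> UNIV \<and> subspace W \<and> smooth_on UNIV f \<and> range f \<subseteq> W \<and>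
      Stiefel \<inter> UNIV = {y \<in> UNIV. f y = 0} \<and>
      (\<forall>y\<in>Stiefel \<inter> UNIV. range (frechet_derivative f (at y)) = W)"
    by simp
  then show "\<exists>U W. \<exists>f :: complex^'n^'k \<Rightarrow> complex^'n^'k. open U \<and> x \<in> U \<and> subspace W \<and>
      smooth_on U f \<and> f ` U \<subseteq> W \<and> Stiefel \<inter> U = {y \<in> U. f y = 0} \<and>
      (\<forall>y\<in>Stiefel \<inter> U. range (frechet_derivative f (at y)) = W)"
    by (rule_tac x=UNIV in exI, rule_tac x=W in exI, rule_tac x=f in exI)
qed

lemma coisotropic_Stiefel: "coisotropic_submanifold omega0 (Stiefel :: (complex^'n^'k) set)"
  unfolding coisotropic_submanifold_def
  using embedded_submanifold_Stiefel complement_tangent_Stiefel skew_mult_in_tangent by blast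

section \<open>Points of the isotropic leaves\<close>

text \<open>Right multiplication by \<open>ct x ** x\<close> projects onto the row space of
  \<open>x\<close>. The deviation \<open>q\<close> of a leaf path from its projection solves the
  same linear equation with skew-Hermitian coefficients as the path itself, so its Frobenius norm is
  constant, and it starts at 0. The coefficients \<open>A t\<close> are merely chosen pointwise;
  constancy of the norm makes do with that.\<close>

lemma isotropic_leaf_StiefelD:
  assumes p: "p \<in> isotropic_leaf omega0 Stiefel x" and x: "x \<in> Stiefel"
  shows "p \<in> Stiefel" "p ** ct x ** x = p"
proof -
  obtain y where y: "smooth_on {0..1} y" "y ` {0..1} \<subseteq> Stiefel" "y 0 = x" "y 1 = p"
    and y': "\<And>t. t \<in> {0..1} \<Longrightarrow> vector_derivative y (at t within {0..1})
        \<in> symplectic_complement omega0 (tangent_space Stiefel (y t))"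
    using p unfolding isotropic_leaf_def by auto
  show "p \<in> Stiefel" using y by auto
  obtain U g where g: "open U" "{0..1} \<subseteq> U" "Ck_on (Suc 0) g U" "\<And>t. t \<in> {0..1} \<Longrightarrow> g t = y t"
    using y(1) unfolding smooth_on_def by blast
  have diff: "g differentiable (at t)" if "t \<in> {0..1}" for t
    by (rule Ck_on_Suc_differentiable[OF g(3)]) (use that g(2) in blast)
  define q where "q = (\<lambda>t. y t - y t ** ct x ** x)"
  have "\<exists>A. skew A \<and> (q has_vector_derivative A ** q t) (at t within {0..1})" if t: "t \<in> {0..1}" for t
  proof -
    have "g differentiable (at t within {0..1})"
      by (rule differentiable_at_withinI[OF diff[OF t]])
    then have "y differentiable (at t within {0..1})"
      by (rule differentiable_transform_within[OF _ zero_less_one t]) (rule g(4))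
    then have d: "(y has_vector_derivative vector_derivative y (at t within {0..1})) (at t within {0..1})"
      by (simp add: vector_derivative_works)
    obtain A where A: "skew A" "vector_derivative y (at t within {0..1}) = A ** y t"
      using complement_tangent_Stiefel[OF y'[OF t]] y t by (metis image_subset_iff)
    have "(q has_vector_derivative A ** y t - (A ** y t) ** ct x ** x) (at t within {0..1})"
      unfolding q_def
      by (intro has_vector_derivative_diff d[unfolded A(2)]
          bounded_linear.has_vector_derivative[OF matmul.bounded_linear_left])
    then show ?thesis
      using A(1) by (auto simp: q_def matmul_linear matrix_mul_assoc)
  qed
  then obtain A where A: "\<And>t. t \<in> {0..1} \<Longrightarrow> skew (A t)"
    "\<And>t. t \<in> {0..1} \<Longrightarrow> (q has_vector_derivative A t ** q t) (at t within {0..1})"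
    by metis
  have "((\<lambda>t. Re (trace (q t ** ct (q t)))) has_derivative (\<lambda>h. 0)) (at t within {0..1})"
    if t: "t \<in> {0..1}" for t
  proof -
    have "bounded_linear (\<lambda>M::complex^_^_. Re (trace M))"
      by (auto intro!: linearI simp: linear_conv_bounded_linear[symmetric] trace_def sum.distrib
          sum_distrib_left)
    from bounded_linear.has_vector_derivative[OF this matmul.has_vector_derivative[OF A(2)[OF t]
          ct_has_vector_derivative[OF A(2)[OF t]]]]
    have "((\<lambda>t. Re (trace (q t ** ct (q t)))) has_vector_derivative
        Re (trace (q t ** ct (A t ** q t) + (A t ** q t) ** ct (q t)))) (at t within {0..1})" .
    moreover have "trace (q t ** ct (A t ** q t)) = - trace ((A t ** q t) ** ct (q t))"
      using A(1)[OF t] trace_mul_sym[of "q t ** ct (q t)" "A t"]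
      by (simp add: skew_def ct_mult matmul_linear matrix_mul_assoc) (simp add: trace_def sum_negf)
    ultimately show ?thesis
      by (simp add: trace_add has_vector_derivative_def)
  qed
  then have "Re (trace (q 1 ** ct (q 1))) = Re (trace (q 0 ** ct (q 0)))"
    by (intro has_derivative_zero_unique[of "{0..1}"]) auto
  also have "q 0 = 0"
    using x by (simp add: q_def y Stiefel_iff)
  finally have "q 1 = 0"
    by (intro trace_mult_ct_eq_0) (simp add: matmul.zero_left trace_def)
  then show "p ** ct x ** x = p" by (simp add: q_def y)
qed

text \<open>This converse places the boundary of the model disk in a leaf. The angle is rescaled so
  that the path has parameter interval [0,1].\<close>

lemma rot_in_isotropic_leaf:
  assumes K: "rotation_generator K" and x: "x \<in> Stiefel"
  shows "rot K \<theta> ** x \<in> isotropic_leaf omega0 Stiefel x"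
proof -
  let ?y = "\<lambda>t. rot K (\<theta> * t) ** x"
  have St: "?y t \<in> Stiefel" for t
  proof -
    have "?y t ** ct (?y t) = rot K (\<theta> * t) ** (x ** ct x) ** ct (rot K (\<theta> * t))"
      by (simp add: ct_mult matrix_mul_assoc)
    then show ?thesis using K x by (simp add: Stiefel_iff rot_unitary)
  qed
  have "skew (\<theta> *\<^sub>R K)" using K by (simp add: rotation_generator_def skew_def ct_linear)
  have "vector_derivative ?y (at t within {0..1}) \<in> symplectic_complement omega0 (tangent_space Stiefel (?y t))"
    if "t \<in> {0..1}" for t
  proof -
    have "(?y has_vector_derivative ((\<theta> *\<^sub>R K) ** rot K (\<theta> * t)) ** x) (at t within {0..1})"
      by (intro bounded_linear.has_vector_derivative[OF matmul.bounded_linear_left]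
          rot_has_vector_derivative K)
    then have "vector_derivative ?y (at t within {0..1}) = (\<theta> *\<^sub>R K) ** ?y t"
      using that vector_derivative_within_closed_interval[of 0 1] by (simp add: matrix_mul_assoc)
    then show ?thesis
      using skew_mult_in_complement[OF \<open>skew (\<theta> *\<^sub>R K)\<close> St] by simp
  qed
  moreover have "smooth_on {0..1} ?y"
    by (intro smooth_onI Ck_on_bounded_linear[OF matmul.bounded_linear_left open_UNIV Ck_on_rot])
  ultimately show ?thesis
    unfolding isotropic_leaf_def using St by (intro CollectI exI[of _ ?y]) auto
qed


section \<open>Green's theorem on the unit disk\<close>

lemma mem_unit_disk: "(x, y) \<in> unit_disk \<longleftrightarrow> x\<^sup>2 + y\<^sup>2 \<le> 1"
  by (simp add: dist_Pair_Pair)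

lemma mem_unit_disk_slice:
  "(x, y) \<in> unit_disk \<longleftrightarrow> y \<in> {-1..1} \<and> x \<in> {- sqrt (1 - y\<^sup>2)..sqrt (1 - y\<^sup>2)}"
proof -
  have "x\<^sup>2 \<le> 1 - y\<^sup>2 \<longleftrightarrow> \<bar>x\<bar> \<le> sqrt (1 - y\<^sup>2)"
    by (metis real_sqrt_abs real_sqrt_le_iff)
  moreover have "y \<in> {-1..1}" if "x\<^sup>2 + y\<^sup>2 \<le> 1"
  proof -
    have "y\<^sup>2 \<le> 1" using that zero_le_power2[of x] by linarith
    then show ?thesis by (simp add: abs_square_le_1 abs_le_iff)
  qed
  ultimately show ?thesis
    unfolding mem_unit_disk by (auto simp: abs_le_iff algebra_simps)
qed

lemma unit_disk_swap: "(y, x) \<in> unit_disk \<longleftrightarrow> (x, y) \<in> unit_disk"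
  by (simp add: mem_unit_disk add.commute del: mem_cball)

text \<open>Fubini for the integrand times the indicator of the disk. The second order of
  integration reuses \<open>slice\<close> through the symmetry of the disk under exchange of
  coordinates.\<close>

lemma integral_unit_disk:
  fixes h :: "real \<times> real \<Rightarrow> real"
  assumes "continuous_on unit_disk h"
  shows "integral unit_disk h =
      integral {-1..1} (\<lambda>y. integral {- sqrt (1 - y\<^sup>2)..sqrt (1 - y\<^sup>2)} (\<lambda>x. h (x, y)))" (is ?snd)
    and "integral unit_disk h =
      integral {-1..1} (\<lambda>x. integral {- sqrt (1 - x\<^sup>2)..sqrt (1 - x\<^sup>2)} (\<lambda>y. h (x, y)))" (is ?fst)
proof -
  let ?h = "\<lambda>x y. indicator unit_disk (x, y) *\<^sub>R h (x, y)"
  have int: "set_integrable lborel unit_disk h"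
    unfolding set_integrable_def by (rule borel_integrable_compact[OF compact_cball assms])
  then have *: "integrable (lborel \<Otimes>\<^sub>M lborel) (case_prod ?h)"
    by (simp add: set_integrable_def lborel_prod case_prod_unfold)
  have "integral unit_disk h = (LINT z|lborel. indicator unit_disk z *\<^sub>R h z)"
    using set_borel_integral_eq_integral(2)[OF int] by (simp add: set_lebesgue_integral_def)
  then have tot: "integral unit_disk h = integral\<^sup>L (lborel \<Otimes>\<^sub>M lborel) (case_prod ?h)"
    by (simp add: lborel_prod case_prod_unfold)
  have slice: "(LINT x|lborel. indicator unit_disk (x, y) *\<^sub>R k x) =
      indicator {-1..1} y *\<^sub>R integral {- sqrt (1 - y\<^sup>2)..sqrt (1 - y\<^sup>2)} k"
    if k: "continuous_on {x. (x, y) \<in> unit_disk} k" for k :: "real \<Rightarrow> real" and y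
  proof (cases "y \<in> {-1..1}")
    case True
    let ?S = "{- sqrt (1 - y\<^sup>2)..sqrt (1 - y\<^sup>2)}"
    have S: "{x. (x, y) \<in> unit_disk} = ?S"
      using True by (simp add: mem_unit_disk_slice set_eq_iff del: mem_cball)
    have "indicator unit_disk (x, y) = (indicator ?S x :: real)" for x
      using True by (simp add: indicator_def mem_unit_disk_slice del: mem_cball)
    then have "(LINT x|lborel. indicator unit_disk (x, y) *\<^sub>R k x) = (LINT x:?S|lborel. k x)"
      by (simp add: set_lebesgue_integral_def)
    also have "\<dots> = integral ?S k"
      by (intro set_borel_integral_eq_integral borel_integrable_atLeastAtMost' k[unfolded S])
    finally show ?thesis using True by simp
  next
    case False
    then have "indicator unit_disk (x, y) = (0 :: real)" for x
      by (auto simp: indicator_def mem_unit_disk_slice simp del: mem_cball)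
    then show ?thesis using False by simp
  qed
  have outer: "(LINT y|lborel. indicator {-1..1} y *\<^sub>R I y) = integral {-1..1} I"
    if "integrable lborel (\<lambda>y. indicator {-1..1} y *\<^sub>R I y)" for I :: "real \<Rightarrow> real"
    using set_borel_integral_eq_integral(2)[of "{-1..1}" I] that
    by (simp add: set_integrable_def set_lebesgue_integral_def)
  have 1: "(LINT x|lborel. ?h x y) =
      indicator {-1..1} y *\<^sub>R integral {- sqrt (1 - y\<^sup>2)..sqrt (1 - y\<^sup>2)} (\<lambda>x. h (x, y))" for y
    by (rule slice) (auto intro!: continuous_on_compose2[OF assms] continuous_intros simp del: mem_cball)
  have "integrable lborel (\<lambda>y. LINT x|lborel. ?h x y)"
    "(LINT y|lborel. LINT x|lborel. ?h x y) = integral unit_disk h"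
    using lborel_pair.integrable_snd[OF *] lborel_pair.integral_snd[OF *] tot by simp_all
  then show ?snd
    unfolding 1
    using outer[of "\<lambda>y. integral {- sqrt (1 - y\<^sup>2)..sqrt (1 - y\<^sup>2)} (\<lambda>x. h (x, y))"] by argo
  have 2: "(LINT y|lborel. ?h x y) =
      indicator {-1..1} x *\<^sub>R integral {- sqrt (1 - x\<^sup>2)..sqrt (1 - x\<^sup>2)} (\<lambda>y. h (x, y))" for x
  proof -
    have "(LINT y|lborel. indicator unit_disk (y, x) *\<^sub>R h (x, y)) =
      indicator {-1..1} x *\<^sub>R integral {- sqrt (1 - x\<^sup>2)..sqrt (1 - x\<^sup>2)} (\<lambda>y. h (x, y))"
      by (rule slice)
        (auto intro!: continuous_on_compose2[OF assms] continuous_intros simp: unit_disk_swap[of _ x] simp del: mem_cball)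
    then show ?thesis
      by (simp add: indicator_def unit_disk_swap[of _ x] del: mem_cball)
  qed
  have "integrable lborel (\<lambda>x. LINT y|lborel. ?h x y)"
    "(LINT x|lborel. LINT y|lborel. ?h x y) = integral unit_disk h"
    using lborel_pair.integrable_fst[OF *] lborel_pair.integral_fst[OF *] tot by simp_all
  then show ?fst
    unfolding 2
    using outer[of "\<lambda>x. integral {- sqrt (1 - x\<^sup>2)..sqrt (1 - x\<^sup>2)} (\<lambda>y. h (x, y))"] by argo
qed

text \<open>The substitution avoids the square root in sqrt (1 - y^2), which is not differentiable
  at the endpoints.\<close>

lemma integral_unit_interval_sin:
  fixes k :: "real \<Rightarrow> real"
  assumes "continuous_on {-1..1} k"
  shows "integral {-1..1} k = integral {-pi/2..pi/2} (\<lambda>\<theta>. cos \<theta> * k (sin \<theta>))"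
proof -
  have "((\<lambda>x. cos x *\<^sub>R k (sin x)) has_integral integral {sin (-pi/2)..sin (pi/2)} k) {-pi/2..pi/2}"
    by (rule has_integral_substitution[where c="-1" and d=1])
      (auto intro!: derivative_eq_intros assms)
  then show ?thesis by (simp add: has_integral_iff)
qed

text \<open>Two-sided derivatives on an open interval allow the antiderivative to be composed with
  reflections and translations of the angle.\<close>

lemma continuous_antiderivative:
  fixes F :: "real \<Rightarrow> 'a::banach"
  assumes "continuous_on UNIV F"
  obtains \<Phi> where "\<And>x. x \<in> {a<..<b} \<Longrightarrow> (\<Phi> has_vector_derivative F x) (at x)"
    "\<And>c d. a < c \<Longrightarrow> c \<le> d \<Longrightarrow> d < b \<Longrightarrow> (F has_integral \<Phi> d - \<Phi> c) {c..d}"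
proof -
  obtain \<Phi> where \<Phi>: "\<And>x. x \<in> {a..b} \<Longrightarrow> (\<Phi> has_vector_derivative F x) (at x within {a..b})"
    using antiderivative_continuous[OF continuous_on_subset[OF assms subset_UNIV]] by metis
  have d: "(\<Phi> has_vector_derivative F x) (at x)" if "x \<in> {a<..<b}" for x
    using \<Phi>[of x] that by (simp add: at_within_Icc_at)
  moreover have "(F has_integral \<Phi> d - \<Phi> c) {c..d}" if "a < c" "c \<le> d" "d < b" for c d
    using that by (intro fundamental_theorem_of_calculus) (auto intro!: has_vector_derivative_at_within d)
  ultimately show thesis using that by blast
qed

lemma sqrt_one_minus_sin_squared: "cos \<theta> \<ge> 0 \<Longrightarrow> sqrt (1 - (sin \<theta>)\<^sup>2) = cos \<theta>"
  by (simp add: cos_squared_eq[symmetric])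

text \<open>Integrating along slices leaves the values on two opposite half circles. Each is
  parametrized by a reflected or translated angle, and the pieces are reassembled to one full
  turn.\<close>

lemma green_unit_disk:
  fixes Q :: "real \<times> real \<Rightarrow> real"
  assumes Q: "\<And>z. z \<in> unit_disk \<Longrightarrow> (Q has_derivative DQ z) (at z)"
    and P: "\<And>z. z \<in> unit_disk \<Longrightarrow> (P has_derivative DP z) (at z)"
    and cQ: "continuous_on unit_disk (\<lambda>z. DQ z (1, 0))"
    and cP: "continuous_on unit_disk (\<lambda>z. DP z (0, 1))"
  shows "integral unit_disk (\<lambda>z. DQ z (1, 0)) = integral {-pi..pi} (\<lambda>\<theta>. Q (cos \<theta>, sin \<theta>) * cos \<theta>)"
    and "integral unit_disk (\<lambda>z. DP z (0, 1)) = integral {-pi..pi} (\<lambda>\<theta>. P (cos \<theta>, sin \<theta>) * sin \<theta>)"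
proof -
  have contQ: "continuous_on unit_disk Q" and contP: "continuous_on unit_disk P"
    using Q P by (meson continuous_at_imp_continuous_on has_derivative_continuous)+
  have arc: "(sqrt (1 - y\<^sup>2), y) \<in> unit_disk" "(- sqrt (1 - y\<^sup>2), y) \<in> unit_disk"
    "(y, sqrt (1 - y\<^sup>2)) \<in> unit_disk" "(y, - sqrt (1 - y\<^sup>2)) \<in> unit_disk" if "y \<in> {-1..1}" for y
    using that by (auto simp: mem_unit_disk abs_square_le_1 abs_le_iff simp del: mem_cball)
  have sgn: "- sqrt (1 - y\<^sup>2) \<le> sqrt (1 - y\<^sup>2)" if "y \<in> {-1..1}" for y :: real
    using that by (simp add: abs_square_le_1 abs_le_iff)
  have circle: "(cos \<theta>, sin \<theta>) \<in> unit_disk" for \<theta> by (simp add: mem_unit_disk del: mem_cball)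

  have slice: "integral {- sqrt (1 - y\<^sup>2)..sqrt (1 - y\<^sup>2)} (\<lambda>x. DQ (x, y) (1, 0))
      = Q (sqrt (1 - y\<^sup>2), y) - Q (- sqrt (1 - y\<^sup>2), y)" if y: "y \<in> {-1..1}" for y
  proof (rule integral_unique, rule fundamental_theorem_of_calculus[OF sgn[OF y]])
    fix x assume x: "x \<in> {- sqrt (1 - y\<^sup>2)..sqrt (1 - y\<^sup>2)}"
    then have "(x, y) \<in> unit_disk" using y mem_unit_disk_slice by blast
    have "((\<lambda>x. Q (x, y)) has_derivative (\<lambda>t. DQ (x, y) (t, 0))) (at x)"
      by (rule has_derivative_compose[where f="\<lambda>x. (x, y)" and x=x and g=Q, OF _ Q[OF \<open>(x, y) \<in> unit_disk\<close>]]) (auto intro!: derivative_eq_intros)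
    moreover have "(\<lambda>t. DQ (x, y) (t, 0)) = (\<lambda>t. t *\<^sub>R DQ (x, y) (1, 0))"
    proof
      show "DQ (x, y) (t, 0) = t *\<^sub>R DQ (x, y) (1, 0)" for t
        using linear_scale[OF has_derivative_linear[OF Q[OF \<open>(x, y) \<in> unit_disk\<close>]], of t "(1, 0)"] by simp
    qed
    ultimately have "((\<lambda>x. Q (x, y)) has_vector_derivative DQ (x, y) (1, 0)) (at x)"
      by (simp only: has_vector_derivative_def)
    then show "((\<lambda>x. Q (x, y)) has_vector_derivative DQ (x, y) (1, 0))
        (at x within {- sqrt (1 - y\<^sup>2)..sqrt (1 - y\<^sup>2)})"
      by (rule has_vector_derivative_at_within)
  qed
  define F where "F = (\<lambda>\<theta>. Q (cos \<theta>, sin \<theta>) * cos \<theta>)"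
  have "continuous_on UNIV F"
    unfolding F_def by (intro continuous_intros continuous_on_compose2[OF contQ]) (use circle in auto)
  \<comment> \<open>The interval only has to contain all angles that occur, the largest being 3 pi /
    2.\<close>
  from continuous_antiderivative[OF this, of "-10" 10] obtain \<Phi>
    where \<Phi>: "\<And>x. x \<in> {-10<..<10} \<Longrightarrow> (\<Phi> has_vector_derivative F x) (at x)"
      "\<And>c d. - 10 < c \<Longrightarrow> c \<le> d \<Longrightarrow> d < 10 \<Longrightarrow> (F has_integral \<Phi> d - \<Phi> c) {c..d}" by metis
  have pi10: "pi < 4" "pi > 0" using pi_less_4 by auto
  have "integral unit_disk (\<lambda>z. DQ z (1, 0)) =
      integral {-1..1} (\<lambda>y. Q (sqrt (1 - y\<^sup>2), y) - Q (- sqrt (1 - y\<^sup>2), y))"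
    unfolding integral_unit_disk(1)[OF cQ] by (intro integral_cong slice)
  also have "\<dots> = integral {-pi/2..pi/2} (\<lambda>\<theta>. cos \<theta> *
      (Q (sqrt (1 - (sin \<theta>)\<^sup>2), sin \<theta>) - Q (- sqrt (1 - (sin \<theta>)\<^sup>2), sin \<theta>)))"
    by (intro integral_unit_interval_sin continuous_intros continuous_on_compose2[OF contQ])
      (use arc in auto)
  also have "\<dots> = integral {-pi/2..pi/2} (\<lambda>\<theta>. F \<theta> + F (pi - \<theta>))"
    using cos_ge_zero by (intro integral_cong) (simp add: sqrt_one_minus_sin_squared F_def algebra_simps)
  also have "\<dots> = (\<Phi> (pi/2) - \<Phi> (pi - pi/2)) - (\<Phi> (-pi/2) - \<Phi> (pi - (-pi/2)))"
  proof (rule integral_unique, rule fundamental_theorem_of_calculus)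
    fix x assume x: "x \<in> {-pi/2..pi/2}"
    have "((\<lambda>x. \<Phi> (pi - x)) has_vector_derivative (-1) *\<^sub>R F (pi - x)) (at x)"
      by (rule vector_diff_chain_at[of "\<lambda>x. pi - x" _ x \<Phi>, unfolded o_def])
        (use x pi10 in \<open>auto intro!: \<Phi> derivative_eq_intros\<close>)
    then have "((\<lambda>x. \<Phi> x - \<Phi> (pi - x)) has_vector_derivative F x - (-1) *\<^sub>R F (pi - x)) (at x)"
      using x pi10 by (intro has_vector_derivative_diff \<Phi>) auto
    then show "((\<lambda>x. \<Phi> x - \<Phi> (pi - x)) has_vector_derivative F x + F (pi - x)) (at x within {-pi/2..pi/2})"
      by (auto intro: has_vector_derivative_at_within)
  qed auto
  also have "\<dots> = (\<Phi> (pi + pi/2) - \<Phi> (- pi/2))" by (simp add: field_simps)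
  also have "\<dots> = (\<Phi> pi - \<Phi> (- pi/2)) + (\<Phi> (pi + pi/2) - \<Phi> pi)" by simp
  \<comment> \<open>The angles run from -pi/2 to 3 pi / 2 so far; periodicity moves the last quarter
    turn to the front.\<close>
  also have "\<Phi> (pi + pi/2) - \<Phi> pi = \<Phi> (-pi/2) - \<Phi> (-pi)"
  proof -
    have "integral {-pi + 2*pi..-pi/2 + 2*pi} F = integral {-pi..-pi/2} (F \<circ> (\<lambda>x. x + 2*pi))"
      by (rule integral_shift[symmetric]) (rule continuous_on_subset[OF \<open>continuous_on UNIV F\<close>], simp)
    also have "F \<circ> (\<lambda>x. x + 2*pi) = F" by (simp add: F_def fun_eq_iff)
    finally show ?thesis
      using \<Phi>(2)[of "-pi" "-pi/2", THEN integral_unique] \<Phi>(2)[of pi "pi + pi/2", THEN integral_unique] pi10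
      by (simp add: field_simps)
  qed
  also have "(\<Phi> pi - \<Phi> (- pi/2)) + (\<Phi> (-pi/2) - \<Phi> (-pi)) = integral {-pi..pi} F"
    using \<Phi>(2)[of "-pi" pi, THEN integral_unique] pi10 by simp
  finally show "integral unit_disk (\<lambda>z. DQ z (1, 0)) = integral {-pi..pi} (\<lambda>\<theta>. Q (cos \<theta>, sin \<theta>) * cos \<theta>)"
    by (simp add: F_def)

  have slice: "integral {- sqrt (1 - x\<^sup>2)..sqrt (1 - x\<^sup>2)} (\<lambda>y. DP (x, y) (0, 1))
      = P (x, sqrt (1 - x\<^sup>2)) - P (x, - sqrt (1 - x\<^sup>2))" if x: "x \<in> {-1..1}" for x
  proof (rule integral_unique, rule fundamental_theorem_of_calculus[OF sgn[OF x]])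
    fix y assume y: "y \<in> {- sqrt (1 - x\<^sup>2)..sqrt (1 - x\<^sup>2)}"
    then have xy: "(x, y) \<in> unit_disk" using x mem_unit_disk_slice unit_disk_swap by blast
    have "((\<lambda>y. P (x, y)) has_derivative (\<lambda>t. DP (x, y) (0, t))) (at y)"
      by (rule has_derivative_compose[where f="\<lambda>y. (x, y)" and x=y and g=P, OF _ P[OF xy]]) (auto intro!: derivative_eq_intros)
    moreover have "(\<lambda>t. DP (x, y) (0, t)) = (\<lambda>t. t *\<^sub>R DP (x, y) (0, 1))"
    proof
      show "DP (x, y) (0, t) = t *\<^sub>R DP (x, y) (0, 1)" for t
        using linear_scale[OF has_derivative_linear[OF P[OF xy]], of t "(0, 1)"] by simp
    qed
    ultimately have "((\<lambda>y. P (x, y)) has_vector_derivative DP (x, y) (0, 1)) (at y)"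
      by (simp only: has_vector_derivative_def)
    then show "((\<lambda>y. P (x, y)) has_vector_derivative DP (x, y) (0, 1))
        (at y within {- sqrt (1 - x\<^sup>2)..sqrt (1 - x\<^sup>2)})"
      by (rule has_vector_derivative_at_within)
  qed
  define G where "G = (\<lambda>\<theta>. P (cos \<theta>, sin \<theta>) * sin \<theta>)"
  have "continuous_on UNIV G"
    unfolding G_def by (intro continuous_intros continuous_on_compose2[OF contP]) (use circle in auto)
  from continuous_antiderivative[OF this, of "-10" 10] obtain \<Psi>
    where \<Psi>: "\<And>x. x \<in> {-10<..<10} \<Longrightarrow> (\<Psi> has_vector_derivative G x) (at x)"
      "\<And>c d. - 10 < c \<Longrightarrow> c \<le> d \<Longrightarrow> d < 10 \<Longrightarrow> (G has_integral \<Psi> d - \<Psi> c) {c..d}" by metis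
  have "integral unit_disk (\<lambda>z. DP z (0, 1)) =
      integral {-1..1} (\<lambda>x. P (x, sqrt (1 - x\<^sup>2)) - P (x, - sqrt (1 - x\<^sup>2)))"
    unfolding integral_unit_disk(2)[OF cP] by (intro integral_cong slice)
  also have "\<dots> = integral {-pi/2..pi/2} (\<lambda>\<theta>. cos \<theta> *
      (P (sin \<theta>, sqrt (1 - (sin \<theta>)\<^sup>2)) - P (sin \<theta>, - sqrt (1 - (sin \<theta>)\<^sup>2))))"
    by (intro integral_unit_interval_sin continuous_intros continuous_on_compose2[OF contP])
      (use arc in auto)
  \<comment> \<open>The upper arc uses angles in [0, pi] and the lower one angles in [-pi, 0], so
    these already fit together.\<close>
  also have "\<dots> = integral {-pi/2..pi/2} (\<lambda>\<theta>. G (pi/2 - \<theta>) + G (\<theta> - pi/2))"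
  proof (intro integral_cong)
    fix \<theta> assume "\<theta> \<in> {-pi/2..pi/2}"
    then have "cos \<theta> \<ge> 0" by (auto intro: cos_ge_zero)
    moreover have "sin (\<theta> - pi/2) = - cos \<theta>" "cos (\<theta> - pi/2) = sin \<theta>"
      "sin (pi/2 - \<theta>) = cos \<theta>" "cos (pi/2 - \<theta>) = sin \<theta>"
      by (simp_all add: sin_diff cos_diff)
    ultimately show "cos \<theta> * (P (sin \<theta>, sqrt (1 - (sin \<theta>)\<^sup>2)) - P (sin \<theta>, - sqrt (1 - (sin \<theta>)\<^sup>2)))
        = G (pi/2 - \<theta>) + G (\<theta> - pi/2)"
      by (simp add: sqrt_one_minus_sin_squared G_def algebra_simps)
  qed
  also have "\<dots> = (\<Psi> (pi/2 - pi/2) - \<Psi> (pi/2 - pi/2)) - (\<Psi> (-pi/2 - pi/2) - \<Psi> (pi/2 - (-pi/2)))"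
  proof (rule integral_unique, rule fundamental_theorem_of_calculus)
    fix x assume x: "x \<in> {-pi/2..pi/2}"
    have 1: "((\<lambda>x. \<Psi> (pi/2 - x)) has_vector_derivative (-1) *\<^sub>R G (pi/2 - x)) (at x)"
      by (rule vector_diff_chain_at[of "\<lambda>x. pi/2 - x" _ x \<Psi>, unfolded o_def])
        (use x pi10 in \<open>auto intro!: \<Psi> derivative_eq_intros\<close>)
    have 2: "((\<lambda>x. \<Psi> (x - pi/2)) has_vector_derivative 1 *\<^sub>R G (x - pi/2)) (at x)"
      by (rule vector_diff_chain_at[of "\<lambda>x. x - pi/2" _ x \<Psi>, unfolded o_def])
        (use x pi10 in \<open>auto intro!: \<Psi> derivative_eq_intros\<close>)
    from has_vector_derivative_diff[OF 2 1]
    show "((\<lambda>x. \<Psi> (x - pi/2) - \<Psi> (pi/2 - x)) has_vector_derivative G (pi/2 - x) + G (x - pi/2))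
        (at x within {-pi/2..pi/2})"
      by (auto intro: has_vector_derivative_at_within simp: add.commute)
  qed auto
  also have "\<dots> = integral {-pi..pi} G"
    using \<Psi>(2)[of "-pi" pi, THEN integral_unique] pi10 by (simp add: field_simps)
  finally show "integral unit_disk (\<lambda>z. DP z (0, 1)) = integral {-pi..pi} (\<lambda>\<theta>. P (cos \<theta>, sin \<theta>) * sin \<theta>)"
    by (simp add: G_def)
qed


section \<open>Symmetry of second derivatives\<close>

text \<open>The second difference over a small square equals h^2 times either mixed derivative at
  some interior point, by the mean value theorem in both orders; continuity then compares the values
  at the corner.\<close>

lemma mixed_partials_real:
  fixes F :: "real \<Rightarrow> real \<Rightarrow> real"
  assumes e: "e > 0"
    and Fx: "\<And>x y. \<bar>x - a\<bar> < e \<Longrightarrow> \<bar>y - b\<bar> < e \<Longrightarrow> ((\<lambda>x. F x y) has_real_derivative Fx x y) (at x)"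
    and Fy: "\<And>x y. \<bar>x - a\<bar> < e \<Longrightarrow> \<bar>y - b\<bar> < e \<Longrightarrow> ((\<lambda>y. F x y) has_real_derivative Fy x y) (at y)"
    and Fxy: "\<And>x y. \<bar>x - a\<bar> < e \<Longrightarrow> \<bar>y - b\<bar> < e \<Longrightarrow> ((\<lambda>y. Fx x y) has_real_derivative Fxy (x, y)) (at y)"
    and Fyx: "\<And>x y. \<bar>x - a\<bar> < e \<Longrightarrow> \<bar>y - b\<bar> < e \<Longrightarrow> ((\<lambda>x. Fy x y) has_real_derivative Fyx (x, y)) (at x)"
    and cont: "isCont Fxy (a, b)" "isCont Fyx (a, b)"
  shows "Fxy (a, b) = Fyx (a, b)"
proof (rule ccontr)
  assume "Fxy (a, b) \<noteq> Fyx (a, b)"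
  define \<epsilon> where "\<epsilon> = \<bar>Fxy (a, b) - Fyx (a, b)\<bar> / 2"
  have "\<epsilon> > 0" using \<open>Fxy (a, b) \<noteq> Fyx (a, b)\<close> by (simp add: \<epsilon>_def)
  then obtain d1 d2 where d1: "d1 > 0" "\<And>z. dist z (a, b) < d1 \<Longrightarrow> dist (Fxy z) (Fxy (a, b)) < \<epsilon>"
    and d2: "d2 > 0" "\<And>z. dist z (a, b) < d2 \<Longrightarrow> dist (Fyx z) (Fyx (a, b)) < \<epsilon>"
    using cont unfolding continuous_at_eps_delta by metis
  \<comment> \<open>Points of the open square are closer than 2 h to the corner, hence the
    halves.\<close>
  define h where "h = min (e / 2) (min (d1 / 2) (d2 / 2))"
  have h: "h > 0" "h < e" "2 * h \<le> d1" "2 * h \<le> d2"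
    using e d1(1) d2(1) by (auto simp: h_def)
  define \<Delta> where "\<Delta> = F (a + h) (b + h) - F (a + h) b - F a (b + h) + F a b"
  have "\<exists>\<xi>. a < \<xi> \<and> \<xi> < a + h \<and> (F (a + h) (b + h) - F (a + h) b) - (F a (b + h) - F a b) =
      (a + h - a) * (Fx \<xi> (b + h) - Fx \<xi> b)"
    by (rule MVT2) (use h in \<open>auto intro!: DERIV_diff Fx\<close>)
  then obtain \<xi> where \<xi>: "a < \<xi>" "\<xi> < a + h" "\<Delta> = h * (Fx \<xi> (b + h) - Fx \<xi> b)"
    by (auto simp: \<Delta>_def)
  have "\<exists>\<eta>. b < \<eta> \<and> \<eta> < b + h \<and> Fx \<xi> (b + h) - Fx \<xi> b = (b + h - b) * Fxy (\<xi>, \<eta>)"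
    by (rule MVT2) (use h \<xi> in \<open>auto intro!: Fxy\<close>)
  then obtain \<eta> where \<eta>: "b < \<eta>" "\<eta> < b + h" "\<Delta> = h * (h * Fxy (\<xi>, \<eta>))"
    using \<xi> by auto
  have "\<exists>\<eta>'. b < \<eta>' \<and> \<eta>' < b + h \<and> (F (a + h) (b + h) - F a (b + h)) - (F (a + h) b - F a b) =
      (b + h - b) * (Fy (a + h) \<eta>' - Fy a \<eta>')"
    by (rule MVT2) (use h in \<open>auto intro!: DERIV_diff Fy\<close>)
  then obtain \<eta>' where \<eta>': "b < \<eta>'" "\<eta>' < b + h" "\<Delta> = h * (Fy (a + h) \<eta>' - Fy a \<eta>')"
    by (auto simp: \<Delta>_def)
  have "\<exists>\<xi>'. a < \<xi>' \<and> \<xi>' < a + h \<and> Fy (a + h) \<eta>' - Fy a \<eta>' = (a + h - a) * Fyx (\<xi>', \<eta>')"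
    by (rule MVT2) (use h \<eta>' in \<open>auto intro!: Fyx\<close>)
  then obtain \<xi>' where \<xi>': "a < \<xi>'" "\<xi>' < a + h" "\<Delta> = h * (h * Fyx (\<xi>', \<eta>'))"
    using \<eta>' by auto
  have near: "dist (x, y) (a, b) < 2 * h" if "a < x" "x < a + h" "b < y" "y < b + h" for x y
  proof -
    have "dist (x, y) (a, b) \<le> \<bar>x - a\<bar> + \<bar>y - b\<bar>"
      unfolding dist_Pair_Pair dist_real_def using sqrt_sum_squares_le_sum_abs by simp
    then show ?thesis using that by simp
  qed
  have "Fxy (\<xi>, \<eta>) = Fyx (\<xi>', \<eta>')" using \<eta>(3) \<xi>'(3) h(1) by simp
  moreover have "dist (Fxy (\<xi>, \<eta>)) (Fxy (a, b)) < \<epsilon>"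
    using near[OF \<xi>(1,2) \<eta>(1,2)] h by (intro d1(2)) linarith
  moreover have "dist (Fyx (\<xi>', \<eta>')) (Fyx (a, b)) < \<epsilon>"
    using near[OF \<xi>'(1,2) \<eta>'(1,2)] h by (intro d2(2)) linarith
  ultimately have "dist (Fxy (a, b)) (Fyx (a, b)) < \<epsilon> + \<epsilon>"
    using dist_triangle3[of "Fxy (a, b)" "Fyx (a, b)" "Fxy (\<xi>, \<eta>)"] by simp
  then show False
    by (simp add: \<epsilon>_def dist_real_def)
qed

lemma has_derivative_partials:
  fixes f :: "real \<times> real \<Rightarrow> 'a::real_normed_vector"
  assumes "(f has_derivative D) (at (x, y))"
  shows "((\<lambda>x. f (x, y)) has_vector_derivative D (1, 0)) (at x)"
    and "((\<lambda>y. f (x, y)) has_vector_derivative D (0, 1)) (at y)"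
proof -
  interpret linear D by (rule has_derivative_linear[OF assms])
  have "D (t, 0) = t *\<^sub>R D (1, 0)" "D (0, t) = t *\<^sub>R D (0, 1)" for t
    using scale[of t "(1, 0)"] scale[of t "(0, 1)"]
    by (simp_all only: scaleR_Pair real_scaleR_def mult_1_right mult_zero_right)
  then have eq: "(\<lambda>t. D (t, 0)) = (\<lambda>t. t *\<^sub>R D (1, 0))" "(\<lambda>t. D (0, t)) = (\<lambda>t. t *\<^sub>R D (0, 1))"
    by (rule_tac [!] ext)
  have "((\<lambda>x. (x, y)) has_derivative (\<lambda>t. (t, 0))) (at x)" "((\<lambda>y. (x, y)) has_derivative (\<lambda>t. (0, t))) (at y)"
    by (auto intro!: derivative_eq_intros)
  from has_derivative_compose[OF this(1) assms] has_derivative_compose[OF this(2) assms]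
  show "((\<lambda>x. f (x, y)) has_vector_derivative D (1, 0)) (at x)"
    "((\<lambda>y. f (x, y)) has_vector_derivative D (0, 1)) (at y)"
    by (simp_all only: has_vector_derivative_def eq)
qed

text \<open>The mean value theorem is scalar, so the identity is checked on each coordinate.\<close>

lemma mixed_partials:
  fixes g :: "real \<times> real \<Rightarrow> 'a::euclidean_space"
  assumes g: "Ck_on (Suc (Suc 0)) g U" and U: "open U" "z \<in> U"
  defines "gx \<equiv> \<lambda>z. frechet_derivative g (at z) (1, 0)"
    and "gy \<equiv> \<lambda>z. frechet_derivative g (at z) (0, 1)"
  shows "frechet_derivative gx (at z) (0, 1) = frechet_derivative gy (at z) (1, 0)"
proof (rule euclidean_eqI)
  fix k :: 'a assume "k \<in> Basis"
  obtain a b where z: "z = (a, b)" by fastforce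
  obtain r where r: "r > 0" "ball z r \<subseteq> U" using U by (metis open_contains_ball)
  have ingU: "(x, y) \<in> U" if "\<bar>x - a\<bar> < r / 2" "\<bar>y - b\<bar> < r / 2" for x y
  proof -
    have "dist (x, y) (a, b) \<le> \<bar>x - a\<bar> + \<bar>y - b\<bar>"
      unfolding dist_Pair_Pair dist_real_def
      using sqrt_sum_squares_le_sum_abs by simp
    then show ?thesis using that r z by (intro subsetD[OF r(2)]) (simp add: dist_commute)
  qed
  have gxy: "Ck_on (Suc 0) gx U" "Ck_on (Suc 0) gy U"
    unfolding gx_def gy_def by (rule Ck_on_Suc_frechet_derivative[OF g])+
  have D: "(f has_derivative frechet_derivative f (at w)) (at w)" if "Ck_on (Suc n) f U" "w \<in> U"
    for f :: "real \<times> real \<Rightarrow> 'a" and n w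
    using Ck_on_Suc_differentiable[OF that] by (simp only: frechet_derivative_works)
  have inner: "((\<lambda>t. h t \<bullet> k) has_real_derivative h' \<bullet> k) (at t)"
    if "(h has_vector_derivative h') (at t)" for h h' and t :: real
    using bounded_linear.has_vector_derivative[OF bounded_linear_inner_left that]
    by (simp only: has_real_derivative_iff_has_vector_derivative)
  have cont: "isCont (\<lambda>w. frechet_derivative f (at w) v \<bullet> k) (a, b)" if "Ck_on (Suc 0) f U"
    for f :: "real \<times> real \<Rightarrow> 'a" and v
  proof -
    have "continuous_on U (\<lambda>w. frechet_derivative f (at w) v)"
      using Ck_on_Suc_frechet_derivative[OF that] by (simp only: Ck_on.simps)
    then have "continuous_on U (\<lambda>w. frechet_derivative f (at w) v \<bullet> k)"
      by (intro continuous_on_inner continuous_on_const)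
    then show ?thesis using U z by (simp add: continuous_on_eq_continuous_at)
  qed
  show "frechet_derivative gx (at z) (0, 1) \<bullet> k = frechet_derivative gy (at z) (1, 0) \<bullet> k"
    unfolding z
  proof (rule mixed_partials_real[where F="\<lambda>x y. g (x, y) \<bullet> k" and e="r / 2"
      and Fx="\<lambda>x y. gx (x, y) \<bullet> k" and Fy="\<lambda>x y. gy (x, y) \<bullet> k"
      and Fxy="\<lambda>w. frechet_derivative gx (at w) (0, 1) \<bullet> k"
      and Fyx="\<lambda>w. frechet_derivative gy (at w) (1, 0) \<bullet> k"])
    fix x y assume "\<bar>x - a\<bar> < r / 2" "\<bar>y - b\<bar> < r / 2"
    note w = ingU[OF this]
    show "((\<lambda>x. g (x, y) \<bullet> k) has_real_derivative gx (x, y) \<bullet> k) (at x)"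
      "((\<lambda>y. g (x, y) \<bullet> k) has_real_derivative gy (x, y) \<bullet> k) (at y)"
      unfolding gx_def gy_def by (intro inner has_derivative_partials D[OF g w])+
    show "((\<lambda>y. gx (x, y) \<bullet> k) has_real_derivative frechet_derivative gx (at (x, y)) (0, 1) \<bullet> k) (at y)"
      by (intro inner has_derivative_partials D[OF gxy(1) w])
    show "((\<lambda>x. gy (x, y) \<bullet> k) has_real_derivative frechet_derivative gy (at (x, y)) (1, 0) \<bullet> k) (at x)"
      by (intro inner has_derivative_partials D[OF gxy(2) w])
  qed (use r in \<open>auto intro!: cont gxy simp del: Ck_on.simps\<close>)
qed

section \<open>Symplectic area as a boundary integral\<close>

text \<open>Derivatives within the disk agree with those of the extension at interior points, and
  the circle is negligible.\<close>

lemma symplectic_area_extension: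
  assumes g: "Ck_on (Suc 0) g U" and U: "open U" "unit_disk \<subseteq> U" and eq: "\<And>z. z \<in> unit_disk \<Longrightarrow> g z = u z"
  shows "symplectic_area \<omega> u = integral unit_disk
    (\<lambda>z. \<omega> (frechet_derivative g (at z) (1, 0)) (frechet_derivative g (at z) (0, 1)))"
  unfolding symplectic_area_def
proof (rule integral_spike[OF negligible_sphere[of "(0,0)" 1]])
  fix z :: "real \<times> real" assume "z \<in> unit_disk - unit_circle"
  then have z: "z \<in> ball (0, 0) 1" by (simp add: dist_norm)
  then have "(g has_derivative frechet_derivative g (at z)) (at z)"
    using Ck_on_Suc_differentiable[OF g, of z] U(2) z ball_subset_cball
    by (simp only: frechet_derivative_works) blast
  then have "(u has_derivative frechet_derivative g (at z)) (at z)"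
    by (rule has_derivative_transform_within_open[OF _ open_ball z]) (simp add: eq)
  then have "frechet_derivative u (at z) = frechet_derivative g (at z)"
    using frechet_derivative_at by metis
  moreover have "at z within unit_disk = at z"
    using z by (intro at_within_interior) (simp add: interior_cball)
  ultimately show "\<omega> (frechet_derivative g (at z) (1, 0)) (frechet_derivative g (at z) (0, 1)) =
      \<omega> (frechet_derivative u (at z within unit_disk) (1, 0)) (frechet_derivative u (at z within unit_disk) (0, 1))"
    by simp
qed

text \<open>Half of \<omega>(p, dp) is a primitive of \<omega>. With Q = \<omega>(g, g_y) and P =
  \<omega>(g, g_x) the mixed second derivatives cancel in Q_x - P_y, and antisymmetry leaves twice
  \<omega>(g_x, g_y).\<close>

lemma symplectic_area_boundary:
  fixes u :: "real \<times> real \<Rightarrow> 'a::euclidean_space"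
  assumes bil: "bounded_bilinear \<omega>" and anti: "\<And>v w. \<omega> v w = - \<omega> w v" and u: "smooth_on unit_disk u"
  obtains c' where "continuous_on UNIV c'"
    "\<And>\<theta>. ((\<lambda>\<theta>. u (cos \<theta>, sin \<theta>)) has_vector_derivative c' \<theta>) (at \<theta>)"
    "symplectic_area \<omega> u = (1/2) * integral {-pi..pi} (\<lambda>\<theta>. \<omega> (u (cos \<theta>, sin \<theta>)) (c' \<theta>))"
proof -
  interpret \<omega>: bounded_bilinear \<omega> by (rule bil)
  obtain U g where U: "open U" "unit_disk \<subseteq> U" and g: "\<And>n. Ck_on n g U"
    and eq: "\<And>z. z \<in> unit_disk \<Longrightarrow> g z = u z"
    using u unfolding smooth_on_def by blast
  define gx where "gx = (\<lambda>z. frechet_derivative g (at z) (1, 0))"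
  define gy where "gy = (\<lambda>z. frechet_derivative g (at z) (0, 1))"
  have Ck: "Ck_on n gx U" "Ck_on n gy U" for n
    unfolding gx_def gy_def by (rule Ck_on_Suc_frechet_derivative[OF g])+
  have D: "(f has_derivative frechet_derivative f (at z)) (at z)" if "Ck_on (Suc 0) f U" "z \<in> unit_disk"
    for f :: "real \<times> real \<Rightarrow> 'a" and z
    using Ck_on_Suc_differentiable[OF that(1)] that(2) U(2)
    by (simp only: frechet_derivative_works) blast
  have cont: "continuous_on unit_disk f" if "\<And>n. Ck_on n f U" for f :: "real \<times> real \<Rightarrow> 'a"
    using that[of 0] U(2) by (simp add: continuous_on_subset)
  have cont': "continuous_on unit_disk (\<lambda>z. frechet_derivative f (at z) v)" if "\<And>n. Ck_on n f U"
    for f :: "real \<times> real \<Rightarrow> 'a" and v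
    by (rule cont, rule Ck_on_Suc_frechet_derivative, rule that)
  define DQ where "DQ = (\<lambda>z v. \<omega> (g z) (frechet_derivative gy (at z) v) + \<omega> (frechet_derivative g (at z) v) (gy z))"
  define DP where "DP = (\<lambda>z v. \<omega> (g z) (frechet_derivative gx (at z) v) + \<omega> (frechet_derivative g (at z) v) (gx z))"
  have Q: "((\<lambda>z. \<omega> (g z) (gy z)) has_derivative DQ z) (at z)"
    and P: "((\<lambda>z. \<omega> (g z) (gx z)) has_derivative DP z) (at z)" if "z \<in> unit_disk" for z
    unfolding DQ_def DP_def by (intro \<omega>.FDERIV D g Ck that)+
  have cDQ: "continuous_on unit_disk (\<lambda>z. DQ z (1, 0))" and cDP: "continuous_on unit_disk (\<lambda>z. DP z (0, 1))"
    unfolding DQ_def DP_def by (intro continuous_on_add \<omega>.continuous_on cont cont' g Ck)+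
  have circle: "(cos \<theta>, sin \<theta>) \<in> unit_disk" for \<theta> by (simp add: mem_unit_disk del: mem_cball)
  define c' where "c' = (\<lambda>\<theta>. (- sin \<theta>) *\<^sub>R gx (cos \<theta>, sin \<theta>) + cos \<theta> *\<^sub>R gy (cos \<theta>, sin \<theta>))"
  have cc: "continuous_on S (\<lambda>\<theta>. f (cos \<theta>, sin \<theta>))" if "\<And>n. Ck_on n f U" for f :: "real \<times> real \<Rightarrow> 'a" and S
    by (rule continuous_on_compose2[OF cont[OF that]]) (use circle in \<open>auto intro!: continuous_intros simp del: mem_cball\<close>)
  have c'cont: "continuous_on S c'" for S
    unfolding c'_def by (intro continuous_intros cc Ck)
  moreover have deriv: "((\<lambda>\<theta>. u (cos \<theta>, sin \<theta>)) has_vector_derivative c' \<theta>) (at \<theta>)" for \<theta>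
  proof -
    let ?D = "frechet_derivative g (at (cos \<theta>, sin \<theta>))"
    have "((\<lambda>\<theta>. (cos \<theta>, sin \<theta>)) has_derivative (\<lambda>t. (t * - sin \<theta>, t * cos \<theta>))) (at \<theta>)"
      by (auto intro!: derivative_eq_intros)
    from has_derivative_compose[OF this D[OF g circle]]
    have "((\<lambda>\<theta>. g (cos \<theta>, sin \<theta>)) has_derivative (\<lambda>t. ?D (t * - sin \<theta>, t * cos \<theta>))) (at \<theta>)" .
    moreover have "?D (t * - sin \<theta>, t * cos \<theta>) = t *\<^sub>R c' \<theta>" for t
    proof -
      interpret linear ?D by (rule has_derivative_linear[OF D[OF g circle]])
      have "(t * - sin \<theta>, t * cos \<theta>) = t *\<^sub>R ((- sin \<theta>) *\<^sub>R (1, 0) + cos \<theta> *\<^sub>R (0, 1))"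
        by simp
      then show ?thesis
        unfolding c'_def gx_def gy_def by (simp only: scale add)
    qed
    moreover have "(\<lambda>\<theta>. g (cos \<theta>, sin \<theta>)) = (\<lambda>\<theta>. u (cos \<theta>, sin \<theta>))"
      using eq circle by blast
    ultimately show ?thesis by (simp only: has_vector_derivative_def)
  qed
  moreover have "symplectic_area \<omega> u = (1/2) * integral {-pi..pi} (\<lambda>\<theta>. \<omega> (u (cos \<theta>, sin \<theta>)) (c' \<theta>))"
  proof -
    have "symplectic_area \<omega> u = integral unit_disk (\<lambda>z. \<omega> (gx z) (gy z))"
      unfolding gx_def gy_def by (rule symplectic_area_extension[OF g U eq])
    also have "\<dots> = integral unit_disk (\<lambda>z. (1/2) * (DQ z (1, 0) - DP z (0, 1)))"
    proof (rule integral_cong)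
      fix z assume z: "z \<in> unit_disk"
      have "frechet_derivative g (at z) (1, 0) = gx z" "frechet_derivative g (at z) (0, 1) = gy z"
        by (simp_all only: gx_def gy_def)
      moreover have "frechet_derivative gx (at z) (0, 1) = frechet_derivative gy (at z) (1, 0)"
        unfolding gx_def gy_def using z U(2) by (intro mixed_partials[OF g U(1)]) blast
      ultimately have "DQ z (1, 0) - DP z (0, 1) = \<omega> (gx z) (gy z) - \<omega> (gy z) (gx z)"
        by (simp add: DQ_def DP_def)
      then show "\<omega> (gx z) (gy z) = (1/2) * (DQ z (1, 0) - DP z (0, 1))"
        using anti[of "gy z" "gx z"] by simp
    qed
    also have "\<dots> = (1/2) * (integral unit_disk (\<lambda>z. DQ z (1, 0)) - integral unit_disk (\<lambda>z. DP z (0, 1)))"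
    proof -
      have "(\<lambda>z. DQ z (1, 0)) integrable_on unit_disk" "(\<lambda>z. DP z (0, 1)) integrable_on unit_disk"
        using borel_integrable_compact[OF compact_cball cDQ] borel_integrable_compact[OF compact_cball cDP]
        by (auto intro!: set_borel_integral_eq_integral(1) simp: set_integrable_def)
      then show ?thesis by (simp add: integral_diff)
    qed
    also have "\<dots> = (1/2) * (integral {-pi..pi} (\<lambda>\<theta>. \<omega> (g (cos \<theta>, sin \<theta>)) (gy (cos \<theta>, sin \<theta>)) * cos \<theta>) -
        integral {-pi..pi} (\<lambda>\<theta>. \<omega> (g (cos \<theta>, sin \<theta>)) (gx (cos \<theta>, sin \<theta>)) * sin \<theta>))"
      by (simp only: green_unit_disk[OF Q P cDQ cDP])
    also have "\<dots> = (1/2) * integral {-pi..pi} (\<lambda>\<theta>. \<omega> (g (cos \<theta>, sin \<theta>)) (gy (cos \<theta>, sin \<theta>)) * cos \<theta> -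
        \<omega> (g (cos \<theta>, sin \<theta>)) (gx (cos \<theta>, sin \<theta>)) * sin \<theta>)"
      by (subst integral_diff)
        (intro integrable_continuous_real continuous_intros \<omega>.continuous_on cc g Ck refl)+
    also have "(\<lambda>\<theta>. \<omega> (g (cos \<theta>, sin \<theta>)) (gy (cos \<theta>, sin \<theta>)) * cos \<theta> -
        \<omega> (g (cos \<theta>, sin \<theta>)) (gx (cos \<theta>, sin \<theta>)) * sin \<theta>) = (\<lambda>\<theta>. \<omega> (u (cos \<theta>, sin \<theta>)) (c' \<theta>))"
      using eq[OF circle]
      by (simp add: fun_eq_iff c'_def \<omega>.add_right \<omega>.diff_right \<omega>.minus_right \<omega>.scaleR_right)
    finally show ?thesis .
  qed
  ultimately show thesis using that by blast
qed


section \<open>Areas of disks with boundary in a leaf\<close>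

text \<open>In the Leibniz formula a permutation other than the identity moves at least two indices.
  After one factor is differentiated an off-diagonal entry of the identity remains, so only the
  diagonal product contributes.\<close>

lemma det_has_vector_derivative_at_identity:
  fixes M :: "real \<Rightarrow> complex^'m^'m"
  assumes M: "(M has_vector_derivative B) (at t)" and "M t = mat 1"
  shows "((\<lambda>s. det (M s)) has_vector_derivative trace B) (at t)"
proof -
  have entry: "((\<lambda>s. M s $ i $ j) has_derivative (\<lambda>h. h *\<^sub>R B $ i $ j)) (at t)" for i j
  proof -
    have "bounded_linear (\<lambda>A::complex^'m^'m. A $ i $ j)"
      by (intro bounded_linear_compose[OF bounded_linear_vec_nth bounded_linear_vec_nth])
    from bounded_linear.has_vector_derivative[OF this M] show ?thesis
      by (simp add: has_vector_derivative_def)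
  qed
  let ?P = "{p. p permutes (UNIV :: 'm set)}"
  have fin: "finite ?P" by (simp add: finite_permutations)
  have D: "((\<lambda>s. det (M s)) has_derivative (\<lambda>h. \<Sum>p\<in>?P. of_int (sign p) *
      (\<Sum>i\<in>UNIV. h *\<^sub>R B $ i $ p i * (\<Prod>j\<in>UNIV - {i}. M t $ j $ p j)))) (at t)"
    unfolding det_def by (intro has_derivative_sum has_derivative_mult_right has_derivative_prod entry)
  have zero: "(\<Prod>j\<in>UNIV - {i}. M t $ j $ p j) = 0" if p: "p permutes UNIV" "p \<noteq> id" for p i
  proof -
    obtain a where a: "p a \<noteq> a" using p by (auto simp: fun_eq_iff)
    have "\<exists>j. j \<noteq> i \<and> p j \<noteq> j"
    proof (cases "a = i")
      case True
      have "p (p a) \<noteq> p a" using a permutes_inj[OF p(1)] by (simp add: inj_eq)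
      then show ?thesis using a True by blast
    qed (use a in blast)
    then obtain j where "j \<noteq> i" "p j \<noteq> j" by blast
    then show ?thesis
      using assms(2) by (intro prod_zero bexI[of _ j]) (auto simp: mat_def)
  qed
  have "(\<Sum>p\<in>?P. of_int (sign p) * (\<Sum>i\<in>UNIV. h *\<^sub>R B $ i $ p i * (\<Prod>j\<in>UNIV - {i}. M t $ j $ p j)))
      = h *\<^sub>R trace B" for h
  proof -
    have "(\<Sum>p\<in>?P. of_int (sign p) * (\<Sum>i\<in>UNIV. h *\<^sub>R B $ i $ p i * (\<Prod>j\<in>UNIV - {i}. M t $ j $ p j)))
        = (\<Sum>p\<in>?P. if p = id then h *\<^sub>R trace B else 0)"
    proof (rule sum.cong)
      fix p assume "p \<in> ?P"
      moreover have "(\<Prod>j\<in>UNIV - {i}. M t $ j $ j) = 1" for i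
        using assms(2) by (simp add: mat_def)
      ultimately show "of_int (sign p) * (\<Sum>i\<in>UNIV. h *\<^sub>R B $ i $ p i * (\<Prod>j\<in>UNIV - {i}. M t $ j $ p j))
          = (if p = id then h *\<^sub>R trace B else 0)"
      proof (cases "p = id")
        case False
        then have "(\<Prod>j\<in>UNIV - {i}. M t $ j $ p j) = 0" for i
          using \<open>p \<in> ?P\<close> by (intro zero) simp_all
        with False show ?thesis by (simp only: mult_zero_right sum.neutral_const if_False)
      qed (simp add: sign_id trace_def scaleR_sum_right)
    qed simp
    also have "\<dots> = h *\<^sub>R trace B"
      using fin by (simp add: sum.delta permutes_id)
    finally show ?thesis .
  qed
  with D show ?thesis by (simp add: has_vector_derivative_def)
qed

text \<open>The integral is \<open>2 \<pi> \<i>\<close> times the winding number of \<open>det U\<close>.\<close>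

lemma unitary_loop_integral:
  fixes U :: "real \<Rightarrow> complex^'m^'m"
  assumes unitary: "\<And>t. U t ** ct (U t) = mat 1"
    and U': "\<And>t. (U has_vector_derivative U' t) (at t)" "continuous_on UNIV U'"
    and closed: "U a = U b" and ab: "a \<le> b"
  obtains m :: int where "((\<lambda>t. trace (U' t ** ct (U t))) has_integral (2 * pi * \<i> * of_int m)) {a..b}"
proof -
  let ?\<tau> = "\<lambda>t. trace (U' t ** ct (U t))"
  have contU: "continuous_on UNIV U"
    using U'(1) by (meson continuous_at_imp_continuous_on has_vector_derivative_continuous)
  have "linear (trace :: complex^'m^'m \<Rightarrow> complex)"
    by (rule linearI) (simp_all add: trace_def sum.distrib scaleR_sum_right)
  then have "bounded_linear (trace :: complex^'m^'m \<Rightarrow> complex)"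
    by (simp only: linear_conv_bounded_linear)
  then have "continuous_on UNIV ?\<tau>"
    by (rule bounded_linear.continuous_on)
      (rule matmul.continuous_on[OF U'(2) bounded_linear.continuous_on[OF bounded_linear_ct contU]])
  then obtain T where T: "\<And>t. t \<in> {a - 1<..<b + 1} \<Longrightarrow> (T has_vector_derivative ?\<tau> t) (at t)"
      "\<And>c d. a - 1 < c \<Longrightarrow> c \<le> d \<Longrightarrow> d < b + 1 \<Longrightarrow> (?\<tau> has_integral T d - T c) {c..d}"
    by (rule continuous_antiderivative[where a="a - 1" and b="b + 1"]) (rule that)
  have D: "((\<lambda>s. det (U s)) has_vector_derivative ?\<tau> t * det (U t)) (at t)" for t
  proof -
    \<comment> \<open>A constant factor moves the base point to the identity, where the derivative
      of the determinant is the trace.\<close>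
    have "((\<lambda>s. U s ** ct (U t)) has_vector_derivative U' t ** ct (U t)) (at t)"
      by (rule bounded_linear.has_vector_derivative[OF matmul.bounded_linear_left U'(1)])
    then have "((\<lambda>s. det (U s ** ct (U t))) has_vector_derivative ?\<tau> t) (at t)"
      by (rule det_has_vector_derivative_at_identity) (rule unitary)
    then have "((\<lambda>s. det (U s ** ct (U t)) * det (U t)) has_vector_derivative ?\<tau> t * det (U t)) (at t)"
      by (rule has_vector_derivative_mult_left)
    moreover have "ct (U t) ** U t = mat 1"
      using unitary[of t] by (simp add: matrix_left_right_inverse)
    then have "det (U s ** ct (U t)) * det (U t) = det (U s)" for s
      by (simp add: det_mul[symmetric] flip: matrix_mul_assoc)
    ultimately show ?thesis by simp
  qed
  \<comment> \<open>\<open>T\<close> is a candidate logarithm of \<open>det (U t)\<close>; the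
    quotient \<open>E\<close> is constant, and closedness of the loop cancels the determinants at
    the ends.\<close>
  define E where "E = (\<lambda>t. exp (- T t) * det (U t))"
  have "(E has_vector_derivative 0) (at t within {a..b})" if t: "t \<in> {a..b}" for t
  proof -
    have "(T has_vector_derivative ?\<tau> t) (at t)" using t by (intro T) auto
    then have "((\<lambda>t. - T t) has_vector_derivative - ?\<tau> t) (at t)"
      by (rule has_vector_derivative_minus)
    then have "((exp \<circ> (\<lambda>t. - T t)) has_vector_derivative (- ?\<tau> t) * exp (- T t)) (at t)"
      by (rule field_vector_diff_chain_at) (rule DERIV_exp)
    from has_vector_derivative_mult[OF this D]
    have "(E has_vector_derivative 0) (at t)" by (simp add: E_def o_def algebra_simps)
    then show ?thesis by (rule has_vector_derivative_at_within)
  qed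
  then have "E b = E a"
    using ab by (intro has_derivative_zero_unique[of "{a..b}" E]) (auto simp: has_vector_derivative_def)
  moreover have "det (U a) \<noteq> 0"
  proof
    assume "det (U a) = 0"
    then have "det (U a ** ct (U a)) = 0" by (simp add: det_mul)
    then show False by (simp add: unitary)
  qed
  ultimately have "exp (- T b) = exp (- T a)"
    using closed by (simp add: E_def)
  then have "exp (T b - T a) = 1"
    by (simp add: exp_diff exp_minus)
  then obtain m :: int where "Re (T b - T a) = 0" "Im (T b - T a) = of_int (2 * m) * pi"
    unfolding exp_eq_1 by blast
  then have m: "T b - T a = 2 * pi * \<i> * of_int m"
    by (simp add: complex_eq_iff)
  have "(?\<tau> has_integral T b - T a) {a..b}"
    by (rule T(2)) (use ab in auto)
  then show thesis
    unfolding m by (rule that)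
qed

text \<open>The boundary curve lifts to the smooth unitary loop \<open>c \<theta> ** ct x\<close>;
  the boundary integrand is the imaginary part of the trace in
  \<open>unitary_loop_integral\<close>.\<close>

lemma symplectic_area_Stiefel_integral:
  assumes u: "smooth_on unit_disk u" and x: "x \<in> Stiefel"
    and leaf: "u ` unit_circle \<subseteq> isotropic_leaf omega0 Stiefel x"
  obtains m :: int where "symplectic_area omega0 u = pi * m"
proof -
  obtain c' where c': "continuous_on UNIV c'"
    "\<And>\<theta>. ((\<lambda>\<theta>. u (cos \<theta>, sin \<theta>)) has_vector_derivative c' \<theta>) (at \<theta>)"
    and area: "symplectic_area omega0 u = (1/2) * integral {-pi..pi} (\<lambda>\<theta>. omega0 (u (cos \<theta>, sin \<theta>)) (c' \<theta>))"
    by (rule symplectic_area_boundary[OF omega0.bounded_bilinear_axioms omega0_antisym u]) (rule that)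
  define c where "c = (\<lambda>\<theta>. u (cos \<theta>, sin \<theta>))"
  have "c \<theta> \<in> isotropic_leaf omega0 Stiefel x" for \<theta>
    using leaf by (auto simp: c_def dist_Pair_Pair image_subset_iff)
  then have c: "c \<theta> ** ct (c \<theta>) = mat 1" "c \<theta> ** ct x ** x = c \<theta>" for \<theta>
    using isotropic_leaf_StiefelD[OF _ x] by (simp_all add: Stiefel_iff)
  have ctc: "ct (c \<theta>) = ct x ** (x ** ct (c \<theta>))" for \<theta>
    using arg_cong[OF c(2), of ct \<theta>] by (simp add: ct_mult)
  define U where "U = (\<lambda>\<theta>. c \<theta> ** ct x)"
  define U' where "U' = (\<lambda>\<theta>. c' \<theta> ** ct x)"
  \<comment> \<open>The projection \<open>ct x ** x\<close> fixes \<open>ct (c \<theta>)\<close> and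
    may be dropped in front of it.\<close>
  have ctU: "M ** ct x ** ct (U \<theta>) = M ** ct (c \<theta>)" for M :: "complex^'a^'b" and \<theta>
    by (subst ctc) (simp add: U_def ct_mult matrix_mul_assoc)
  have "U \<theta> ** ct (U \<theta>) = mat 1" for \<theta>
    using ctU[of "c \<theta>" \<theta>] by (simp add: U_def c)
  moreover have "(U has_vector_derivative U' \<theta>) (at \<theta>)" for \<theta>
    unfolding U_def U'_def c_def
    by (rule bounded_linear.has_vector_derivative[OF matmul.bounded_linear_left c'(2)])
  moreover have "continuous_on UNIV U'"
    unfolding U'_def by (rule bounded_linear.continuous_on[OF matmul.bounded_linear_left c'(1)])
  moreover have "U (-pi) = U pi" by (simp add: U_def c_def)
  ultimately obtain m :: int
    where "((\<lambda>\<theta>. trace (U' \<theta> ** ct (U \<theta>))) has_integral (2 * pi * \<i> * of_int m)) {-pi..pi}"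
    by (rule unitary_loop_integral) simp
  then have "((\<lambda>\<theta>. Im (trace (U' \<theta> ** ct (U \<theta>)))) has_integral Im (2 * pi * \<i> * of_int m)) {-pi..pi}"
    by (rule has_integral_linear[OF _ bounded_linear_Im, unfolded o_def])
  moreover have "Im (trace (U' \<theta> ** ct (U \<theta>))) = omega0 (u (cos \<theta>, sin \<theta>)) (c' \<theta>)" for \<theta>
    unfolding U'_def ctU by (simp add: omega0_trace c_def)
  ultimately have "integral {-pi..pi} (\<lambda>\<theta>. omega0 (u (cos \<theta>, sin \<theta>)) (c' \<theta>)) = 2 * pi * m"
    by (simp add: has_integral_iff)
  then show thesis using area that[of m] by simp
qed

text \<open>The inequality of dimensions provides an injection of row indices into column indices;
  the rows are then distinct standard basis vectors.\<close>

lemma Stiefel_nonempty: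
  assumes "CARD('k) \<le> CARD('n)"
  obtains x :: "complex^'n^'k" where "x \<in> Stiefel"
proof -
  obtain \<iota> :: "'k \<Rightarrow> 'n" where \<iota>: "inj \<iota>"
    using assms card_le_inj[of "UNIV :: 'k set" "UNIV :: 'n set"] by auto
  have "(\<chi> i j. if j = \<iota> i then 1 else 0) \<in> (Stiefel :: (complex^'n^'k) set)"
  proof -
    have "(\<Sum>k\<in>UNIV. (if k = \<iota> i then 1 else 0) * cnj (if k = \<iota> j then 1 else 0)) =
        (\<Sum>k\<in>UNIV. if k = \<iota> i then (if i = j then 1 else 0) else 0 :: complex)" for i j
      using \<iota> by (intro sum.cong) (auto simp: inj_eq)
    then show ?thesis
      by (simp add: Stiefel_iff vec_eq_iff matrix_matrix_mult_def conj_transpose_def mat_def)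
  qed
  then show thesis by (rule that)
qed

lemma Stiefel_row_norm:
  assumes "x \<in> Stiefel"
  shows "(\<Sum>j\<in>UNIV. (cmod (x $ i $ j))\<^sup>2) = 1"
proof -
  have "(x ** ct x) $ i $ i = 1" using assms by (simp add: Stiefel_iff mat_def)
  then have "complex_of_real (\<Sum>j\<in>UNIV. (cmod (x $ i $ j))\<^sup>2) = 1"
    by (simp add: matrix_matrix_mult_def conj_transpose_def complex_norm_square del: of_real_power)
  then show ?thesis by (metis of_real_eq_1_iff)
qed

text \<open>From the left this multiplies row \<open>a\<close> by \<open>cis \<theta>\<close>,
  matching the boundary of the model disk.\<close>

lemma rot_i_unit: "rot (i_unit a) \<theta> = mat 1 + mat (cis \<theta> - 1) ** unit_mat a a"
  by (simp add: rot_def i_unit_def scale_mult_scale unit_mat_mult)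
    (simp add: vec_eq_iff complex_eq_iff algebra_simps)

lemma pi_in_area_spectrum:
  assumes x: "(x :: complex^'n^'k) \<in> Stiefel"
  shows "pi \<in> area_spectrum omega0 (Stiefel :: (complex^'n^'k) set)"
proof -
  fix a :: 'k
  \<comment> \<open>\<open>v\<close> keeps only row \<open>a\<close> of \<open>x\<close>. Thus
    \<open>u\<close> is affine, and its area integrand is constant, equal to the squared norm of
    that row.\<close>
  define v where "v = unit_mat a a ** x"
  define L where "L = (\<lambda>z::real \<times> real. fst z *\<^sub>R v + snd z *\<^sub>R (mat \<i> ** v))"
  define u where "u = (\<lambda>z. (x - v) + L z)"
  have L: "bounded_linear L"
    unfolding L_def by (intro bounded_linear_add bounded_linear_compose[OF bounded_linear_scaleR_left]
        bounded_linear_fst bounded_linear_snd)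
  have Ck: "Ck_on n u UNIV" for n
    unfolding u_def by (intro Ck_on_add Ck_on_const Ck_on_linear L open_UNIV)
  have "(u has_derivative L) (at z)" for z
    unfolding u_def by (auto intro!: derivative_eq_intros bounded_linear_imp_has_derivative[OF L])
  then have du: "frechet_derivative u (at z) = L" for z
    using frechet_derivative_at by metis
  have "symplectic_area omega0 u = integral unit_disk (\<lambda>z. omega0 (L (1, 0)) (L (0, 1)))"
    using symplectic_area_extension[OF Ck, of u] by (simp add: du)
  also have "omega0 (L (1, 0)) (L (0, 1)) = (\<Sum>j\<in>UNIV. (cmod (x $ a $ j))\<^sup>2)"
  proof -
    have "v $ i $ j = (if i = a then x $ a $ j else 0)" for i j
    proof -
      have "(\<Sum>k\<in>UNIV. unit_mat a a $ i $ k * x $ k $ j) =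
          (\<Sum>k\<in>UNIV. if k = a then (if i = a then x $ a $ j else 0) else 0)"
        by (intro sum.cong) (auto simp: unit_mat_def)
      then show ?thesis by (simp add: v_def matrix_matrix_mult_def)
    qed
    then have "omega0 (L (1, 0)) (L (0, 1)) =
        (\<Sum>i\<in>UNIV. \<Sum>j\<in>UNIV. if i = a then (cmod (x $ a $ j))\<^sup>2 else 0)"
      unfolding omega0_def L_def
      by (intro sum.cong) (auto simp: cmod_power2 simp flip: power2_eq_square)
    also have "\<dots> = (\<Sum>i\<in>UNIV. if i = a then (\<Sum>j\<in>UNIV. (cmod (x $ a $ j))\<^sup>2) else 0)"
      by (intro sum.cong) auto
    finally show ?thesis by simp
  qed
  also have "\<dots> = 1" by (rule Stiefel_row_norm[OF x])
  finally have "symplectic_area omega0 u = pi"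
    by (simp add: content_cball unit_ball_vol_2 lmeasurable_cball flip: lmeasure_integral)
  moreover have "u ` unit_circle \<subseteq> isotropic_leaf omega0 Stiefel x"
  proof clarify
    fix p q :: real assume "(p, q) \<in> unit_circle"
    then have "p\<^sup>2 + q\<^sup>2 = 1" by (simp add: dist_Pair_Pair)
    then obtain \<theta> where "p = cos \<theta>" "q = sin \<theta>" using sincos_total_2pi by metis
    then have "u (p, q) = rot (i_unit a) \<theta> ** x"
      by (simp add: u_def L_def v_def rot_i_unit matmul_linear flip: matrix_mul_assoc)
        (simp add: vec_eq_iff complex_eq_iff algebra_simps)
    then show "u (p, q) \<in> isotropic_leaf omega0 Stiefel x"
      using rot_in_isotropic_leaf[OF rotation_generator_i_unit x] by simp
  qed
  ultimately show ?thesis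
    unfolding area_spectrum_def isotropic_leaves_def
    by (intro CollectI exI[of _ u] conjI bexI[of _ "isotropic_leaf omega0 Stiefel x"] imageI
        smooth_onI[OF Ck] x) simp_all
qed

lemma minimal_area_Stiefel:
  assumes "CARD('k) \<le> CARD('n)"
  shows "minimal_area omega0 (Stiefel :: (complex^'n^'k) set) = ereal pi"
  unfolding minimal_area_def
proof (rule cInf_eq_minimum)
  obtain x :: "complex^'n^'k" where "x \<in> Stiefel" using Stiefel_nonempty[OF assms] .
  then show "ereal pi \<in> ereal ` (area_spectrum omega0 (Stiefel :: (complex^'n^'k) set) \<inter> {0<..})"
    by (intro imageI IntI pi_in_area_spectrum) auto
next
  fix A assume "A \<in> ereal ` (area_spectrum omega0 (Stiefel :: (complex^'n^'k) set) \<inter> {0<..})"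
  then obtain r where r: "A = ereal r" "r \<in> area_spectrum omega0 (Stiefel :: (complex^'n^'k) set)" "r > 0"
    by auto
  from r(2) obtain u and F :: "(complex^'n^'k) set" where u: "r = symplectic_area omega0 u"
    "smooth_on unit_disk u" "F \<in> isotropic_leaves omega0 Stiefel" "u ` unit_circle \<subseteq> F"
    unfolding area_spectrum_def mem_Collect_eq by (elim exE conjE bexE) (rule that)
  from u(3) obtain x where x: "x \<in> Stiefel" "F = isotropic_leaf omega0 Stiefel x"
    unfolding isotropic_leaves_def by (elim imageE) (rule that)
  obtain m :: int where m: "symplectic_area omega0 u = pi * m"
    using symplectic_area_Stiefel_integral[OF u(2) x(1) u(4)[unfolded x(2)]] .
  with r(3) u(1) have "m > 0" by (simp add: zero_less_mult_iff)
  then have "pi * 1 \<le> pi * m" by (intro mult_left_mono) auto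
  then show "ereal pi \<le> A" using r(1) u(1) m by simp
qed


section \<open>Displacing the Stiefel manifold\<close>

text \<open>The function is the area of the part of the disk of radius \<open>R\<close> to the left
  of abscissa \<open>x\<close>; its derivative is the chord length.\<close>

lemma circle_area_profile_DERIV:
  fixes R x :: real
  assumes "\<bar>x\<bar> < R"
  shows "((\<lambda>x. x * sqrt (R\<^sup>2 - x\<^sup>2) + R\<^sup>2 * arcsin (x / R) + R\<^sup>2 * pi / 2)
    has_real_derivative 2 * sqrt (R\<^sup>2 - x\<^sup>2)) (at x)"
proof -
  have R: "R > 0" using assms by linarith
  have pos: "R\<^sup>2 - x\<^sup>2 > 0" using power2_strict_mono[of x R] assms by simp
  define s where "s = sqrt (R\<^sup>2 - x\<^sup>2)"
  have s: "s > 0" "s * s = R\<^sup>2 - x\<^sup>2" using pos by (simp_all add: s_def flip: power2_eq_square)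
  have "sqrt (1 - (x / R)\<^sup>2) = s / R"
  proof -
    have "1 - (x / R)\<^sup>2 = (R\<^sup>2 - x\<^sup>2) / R\<^sup>2" using R by (simp add: field_simps)
    then show ?thesis using R by (simp add: s_def real_sqrt_divide)
  qed
  moreover have "-1 < x / R" "x / R < 1" using assms R by (auto simp: field_simps)
  ultimately have "((\<lambda>x. arcsin (x / R)) has_real_derivative 1 / s) (at x)"
    using R by (auto intro!: derivative_eq_intros)
  moreover have "((\<lambda>x. sqrt (R\<^sup>2 - x\<^sup>2)) has_real_derivative - x / s) (at x)"
    using pos unfolding s_def by (auto intro!: derivative_eq_intros simp: field_simps)
  ultimately have "((\<lambda>x. x * sqrt (R\<^sup>2 - x\<^sup>2) + R\<^sup>2 * arcsin (x / R) + R\<^sup>2 * pi / 2)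
      has_real_derivative (1 * sqrt (R\<^sup>2 - x\<^sup>2) + (- x / s) * x) + R\<^sup>2 * (1 / s) + 0) (at x)"
    by (intro DERIV_add DERIV_mult DERIV_ident DERIV_cmult DERIV_const)
  moreover have "(1 * sqrt (R\<^sup>2 - x\<^sup>2) + (- x / s) * x) + R\<^sup>2 * (1 / s) + 0 = 2 * sqrt (R\<^sup>2 - x\<^sup>2)"
    unfolding s_def[symmetric] using s by (simp add: field_simps power2_eq_square)
  ultimately show ?thesis by (rule DERIV_cong)
qed

lemma circle_area_profile_bounds:
  fixes R x :: real
  assumes "\<bar>x\<bar> \<le> R" "R > 0"
  shows "0 \<le> x * sqrt (R\<^sup>2 - x\<^sup>2) + R\<^sup>2 * arcsin (x / R) + R\<^sup>2 * pi / 2"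
    and "x * sqrt (R\<^sup>2 - x\<^sup>2) + R\<^sup>2 * arcsin (x / R) + R\<^sup>2 * pi / 2 \<le> R\<^sup>2 * pi"
proof -
  let ?F = "\<lambda>x. x * sqrt (R\<^sup>2 - x\<^sup>2) + R\<^sup>2 * arcsin (x / R) + R\<^sup>2 * pi / 2"
  have "continuous_on {-R..R} ?F"
    using assms(2) by (intro continuous_intros) (auto simp: field_simps)
  then have mono: "?F a \<le> ?F b" if "-R \<le> a" "a \<le> b" "b \<le> R" for a b
  proof (intro DERIV_nonneg_imp_increasing_open[OF that(2)])
    fix y assume "a < y" "y < b"
    then have "\<bar>y\<bar> < R" using that by linarith
    moreover from this have "R\<^sup>2 - y\<^sup>2 > 0" using power2_strict_mono[of y R] by simp
    ultimately show "\<exists>d. (?F has_real_derivative d) (at y) \<and> 0 \<le> d"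
      by (intro exI[of _ "2 * sqrt (R\<^sup>2 - y\<^sup>2)"] conjI circle_area_profile_DERIV) auto
  qed (rule continuous_on_subset, use that in auto)
  show "0 \<le> ?F x" "?F x \<le> R\<^sup>2 * pi"
    using mono[of "-R" x] mono[of x R] assms by (auto simp: mult.commute[of pi])
qed

text \<open>Smoothness is read off the chord length, a power of a positive polynomial on the open
  interval.\<close>

lemma Ck_on_circle_area_profile:
  "Ck_on n (\<lambda>x. x * sqrt (R\<^sup>2 - x\<^sup>2) + R\<^sup>2 * arcsin (x / R) + R\<^sup>2 * pi / 2) {-R<..<R}"
proof -
  have pos: "R\<^sup>2 - x * x > 0" if "x \<in> {-R<..<R}" for x
    using power2_strict_mono[of x R] that by (simp add: abs_less_iff flip: power2_eq_square)
  have "Ck_on n (\<lambda>x. R\<^sup>2 - x * x) {-R<..<R}" for n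
    by (intro Ck_on_diff Ck_on_mult Ck_on_const Ck_on_linear bounded_linear_ident open_greaterThanLessThan)
  then have "Ck_on n (\<lambda>x. (R\<^sup>2 - x * x) powr (1/2)) {-R<..<R}"
    by (rule Ck_on_compose_real[OF open_greaterThanLessThan open_greaterThan Ck_on_powr]) (use pos in auto)
  then have powr: "Ck_on n (\<lambda>x. 2 * (R\<^sup>2 - x * x) powr (1/2)) {-R<..<R}"
    by (rule Ck_on_mult[OF open_greaterThanLessThan Ck_on_const[OF open_greaterThanLessThan]])
  have "2 * (R\<^sup>2 - x * x) powr (1/2) = 2 * sqrt (R\<^sup>2 - x\<^sup>2)" if "x \<in> {-R<..<R}" for x
    using pos[OF that] by (simp add: powr_half_sqrt power2_eq_square)
  then have "Ck_on n (\<lambda>x. 2 * sqrt (R\<^sup>2 - x\<^sup>2)) {-R<..<R}"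
    by (rule Ck_on_cong[OF open_greaterThanLessThan _ powr])
  then show ?thesis
    by (rule Ck_on_SucD[OF Ck_on_real_deriv[OF open_greaterThanLessThan, rotated]])
      (simp add: circle_area_profile_DERIV abs_less_iff flip: has_real_derivative_iff_has_vector_derivative)
qed

text \<open>A shear by \<open>f'\<close> displaces the unit disk because \<open>f'\<close> exceeds the length of its vertical chords;
  their lengths integrate to the area \<open>\<pi>\<close>, which is therefore the oscillation that \<open>f\<close> needs.\<close>

lemma shear_profile:
  fixes C :: real
  assumes "C > pi"
  obtains f f' :: "real \<Rightarrow> real" and B M :: real where
    "\<And>n. Ck_on n f UNIV" "\<And>x. 0 \<le> f x" "\<And>x. f x \<le> B" "B < C"
    "\<And>x. (f has_real_derivative f' x) (at x)"
    "\<And>x. \<bar>x\<bar> \<le> 1 \<Longrightarrow> 2 * sqrt (1 - x\<^sup>2) < f' x" "\<And>x. \<bar>x\<bar> \<le> 1 \<Longrightarrow> f' x \<le> M"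
proof -
  \<comment> \<open>R^2 is the mean of 1 and \<open>q\<close>: a disk slightly larger than the unit
    disk, still of area below \<open>C\<close>.\<close>
  define q where "q = C / pi"
  have q: "q > 1" "C = q * pi" using assms by (simp_all add: q_def field_simps)
  define R where "R = sqrt ((1 + q) / 2)"
  have R2: "R\<^sup>2 = (1 + q) / 2" and "R > 0" using q(1) by (simp_all add: R_def)
  have R: "R\<^sup>2 > 1" "R\<^sup>2 * pi < C"
    unfolding R2 q(2) using q(1) by (simp_all add: mult_strict_right_mono)
  define F where "F = (\<lambda>x. x * sqrt (R\<^sup>2 - x\<^sup>2) + R\<^sup>2 * arcsin (x / R) + R\<^sup>2 * pi / 2)"
  \<comment> \<open>Three equal margins for x^2: the cutoff is 1 up to 1 + d and 0 from 1 + 2 d on,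
    while the profile stays smooth up to R^2 = 1 + 3 d. Hence the two smooth descriptions of
    \<open>f\<close> cover the line.\<close>
  define d where "d = (R\<^sup>2 - 1) / 3"
  have d: "d > 0" "R\<^sup>2 = 1 + 3 * d" using R(1) by (simp_all add: d_def field_simps)
  define cut where "cut = (\<lambda>x. smooth_step ((1 + 2 * d - x * x) * (1 / d)))"
  have c0: "cut x = 0" if "x\<^sup>2 \<ge> 1 + 2 * d" for x
    unfolding cut_def using that d by (intro smooth_step_eq_0) (simp add: power2_eq_square field_simps)
  have c1: "cut x = 1" if "x\<^sup>2 \<le> 1 + d" for x
    unfolding cut_def using that d by (intro smooth_step_eq_1) (simp add: power2_eq_square field_simps)
  define f where "f = (\<lambda>x. cut x * F x)"
  have inR: "x \<in> {-R<..<R} \<longleftrightarrow> x\<^sup>2 < R\<^sup>2" for x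
    using abs_le_square_iff[of R x] \<open>R > 0\<close> by (auto simp: not_le[symmetric])
  have Ckc: "Ck_on n cut UNIV" for n
    unfolding cut_def
    by (rule Ck_on_compose_real[OF open_UNIV open_UNIV Ck_on_smooth_step])
      (intro Ck_on_diff Ck_on_mult Ck_on_const Ck_on_linear bounded_linear_ident open_UNIV, simp)
  have Ckf: "Ck_on n f UNIV" for n
  proof -
    let ?V = "{x::real. x\<^sup>2 > 1 + 2 * d}"
    have V: "open ?V" by (intro open_Collect_less continuous_intros)
    have "Ck_on n f {-R<..<R}"
      unfolding f_def F_def
      by (intro Ck_on_mult Ck_on_circle_area_profile open_greaterThanLessThan Ck_on_subset[OF Ckc]) auto
    moreover have "Ck_on n f ?V"
      by (rule Ck_on_cong[OF V _ Ck_on_const[OF V, of n 0]]) (simp add: f_def c0)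
    ultimately have "Ck_on n f ({-R<..<R} \<union> ?V)"
      using V by (intro Ck_on_Un) auto
    moreover have "x \<in> {-R<..<R} \<union> ?V" for x
    proof (cases "x\<^sup>2 < R\<^sup>2")
      case True
      then show ?thesis using inR by blast
    next
      case False
      then have "x\<^sup>2 > 1 + 2 * d" using d by linarith
      then show ?thesis by simp
    qed
    then have "{-R<..<R} \<union> ?V = UNIV" by blast
    ultimately show ?thesis by (simp only:)
  qed
  define f' where "f' = deriv f"
  have f': "(f has_real_derivative f' x) (at x)" for x
    using Ck_on_Suc_differentiable[OF Ckf UNIV_I]
    unfolding f'_def by (simp only: DERIV_deriv_iff_real_differentiable)
  have f'_eq: "f' x = 2 * sqrt (R\<^sup>2 - x\<^sup>2)" if "\<bar>x\<bar> \<le> 1" for x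
  proof -
    have x2: "x\<^sup>2 \<le> 1" using that by (simp add: abs_square_le_1)
    then have "x \<in> {-R<..<R}" unfolding inR using R(1) by linarith
    then have "\<bar>x\<bar> < R" by (simp add: abs_less_iff)
    then have "(F has_real_derivative 2 * sqrt (R\<^sup>2 - x\<^sup>2)) (at x)"
      unfolding F_def by (rule circle_area_profile_DERIV)
    moreover have "open {y::real. y\<^sup>2 < 1 + d}" by (intro open_Collect_less continuous_intros)
    ultimately have "(f has_real_derivative 2 * sqrt (R\<^sup>2 - x\<^sup>2)) (at x)"
      by (rule has_field_derivative_transform_within_open) (use x2 d in \<open>auto simp: f_def c1\<close>)
    then show ?thesis using f' DERIV_unique by blast
  qed
  have bounds: "0 \<le> f x \<and> f x \<le> R\<^sup>2 * pi" for x
  proof (cases "\<bar>x\<bar> \<le> R")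
    case True
    have F: "0 \<le> F x" "F x \<le> R\<^sup>2 * pi"
      using circle_area_profile_bounds[OF True \<open>R > 0\<close>] by (simp_all add: F_def)
    have "cut x * F x \<le> 1 * F x"
      using F by (intro mult_right_mono) (simp_all add: cut_def smooth_step_bounds)
    moreover have "0 \<le> cut x * F x"
      using F by (intro mult_nonneg_nonneg) (simp_all add: cut_def smooth_step_bounds)
    ultimately show ?thesis using F by (simp add: f_def)
  next
    case False
    then have "x \<notin> {-R<..<R}" by auto
    then have "x\<^sup>2 \<ge> 1 + 2 * d" unfolding inR using d by linarith
    then show ?thesis by (simp add: f_def c0)
  qed
  show thesis
  proof (rule that[of f "R\<^sup>2 * pi" f' "2 * R"])
    fix x :: real assume x: "\<bar>x\<bar> \<le> 1"
    show "2 * sqrt (1 - x\<^sup>2) < f' x" using R by (simp add: f'_eq[OF x])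
    show "f' x \<le> 2 * R"
      using \<open>R > 0\<close> real_sqrt_le_mono[of "R\<^sup>2 - x\<^sup>2" "R\<^sup>2"] by (simp add: f'_eq[OF x])
  qed (use Ckf bounds R f' in auto)
qed

section \<open>The shear flow and the displacement\<close>

text \<open>The Hamiltonian vector field of the real part of entry (i, j); the sign follows from the
  convention dH = \<omega>(X, .).\<close>

definition shear_dir :: "'k \<Rightarrow> 'n \<Rightarrow> complex^'n^'k" where
  "shear_dir i j = axis i (axis j (- \<i>))"

lemma shear_dir_nth [simp]: "Re (shear_dir i j $ p $ q) = 0"
  "Im (shear_dir i j $ p $ q) = (if p = i \<and> q = j then -1 else 0)"
  by (simp_all add: shear_dir_def axis_def)

lemma omega0_shear_dir: "omega0 (c *\<^sub>R shear_dir i j) w = c * Re (w $ i $ j)"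
proof -
  have "omega0 (c *\<^sub>R shear_dir i j) w =
      (\<Sum>p\<in>UNIV. \<Sum>q\<in>UNIV. if q = j then (if p = i then c * Re (w $ i $ j) else 0) else 0)"
    unfolding omega0_def by (intro sum.cong) auto
  then show ?thesis by simp
qed

lemma norm_shear_dir: "norm (shear_dir i j) = 1"
  by (simp add: shear_dir_def norm_eq_sqrt_inner inner_axis axis_nth inner_complex_def)

lemma hamiltonian_vector_field_shear:
  assumes "(h has_derivative (\<lambda>w. c * Re (w $ i $ j))) (at x)"
  shows "hamiltonian_vector_field omega0 h x = c *\<^sub>R shear_dir i j"
  unfolding hamiltonian_vector_field_def frechet_derivative_at[OF assms, symmetric]
proof (rule the_equality)
  show "\<forall>w. c * Re (w $ i $ j) = omega0 (c *\<^sub>R shear_dir i j) w"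
    by (simp only: omega0_shear_dir simp_thms)
next
  fix v assume v: "\<forall>w. c * Re (w $ i $ j) = omega0 v w"
  have "omega0 (v - c *\<^sub>R shear_dir i j) w = 0" for w
    using v by (simp only: omega0.diff_left omega0_shear_dir diff_self)
  then show "v = c *\<^sub>R shear_dir i j" using omega0_nondegenerate by (metis eq_iff_diff_eq_0)
qed

lemma norm_Stiefel:
  assumes "(x :: complex^'n^'k) \<in> Stiefel"
  shows "norm x = sqrt (CARD('k))"
proof -
  have "norm (x $ i) = 1" for i
    using Stiefel_row_norm[OF assms, of i] by (simp add: norm_vec_def L2_set_def)
  then show ?thesis by (simp add: norm_vec_def[of x] L2_set_def)
qed

lemma Stiefel_entry:
  assumes "x \<in> Stiefel"
  shows "(Re (x $ i $ j))\<^sup>2 + (Im (x $ i $ j))\<^sup>2 \<le> 1"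
proof -
  have "(cmod (x $ i $ j))\<^sup>2 \<le> (\<Sum>j\<in>UNIV. (cmod (x $ i $ j))\<^sup>2)"
    by (rule member_le_sum) auto
  then show ?thesis using Stiefel_row_norm[OF assms, of i] by (simp add: cmod_power2)
qed

text \<open>The field is known only where the norm is below \<open>K\<close>. There the real part of
  the entry is conserved, so the velocity is constant and any trajectory follows the straight line
  \<open>e\<close>. At a first exit time it would still agree with \<open>e\<close>, which stays
  inside. The function \<open>f\<close> here is the derivative of the shear profile in the
  application.\<close>

lemma hamiltonian_flow_shear:
  fixes x :: "complex^'n^'k" and f :: "real \<Rightarrow> real"
  assumes X: "\<And>s z. s \<in> {0..1} \<Longrightarrow> norm z < K \<Longrightarrow>
      hamiltonian_vector_field omega0 (\<lambda>p. H (s, p)) z = f (Re (z $ i $ j)) *\<^sub>R shear_dir i j"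
    and x: "norm x + \<bar>f (Re (x $ i $ j))\<bar> < K"
  shows "hamiltonian_flow omega0 H 1 x = x + f (Re (x $ i $ j)) *\<^sub>R shear_dir i j"
  unfolding hamiltonian_flow_def
proof (rule the_equality)
  let ?c = "f (Re (x $ i $ j))"
  define e where "e = (\<lambda>s. x + (s * ?c) *\<^sub>R shear_dir i j)"
  have e_norm: "norm (e s) < K" if "s \<in> {0..1}" for s
  proof -
    have "norm (e s) \<le> norm x + \<bar>s * ?c\<bar>"
      unfolding e_def by (rule order_trans[OF norm_triangle_ineq]) (simp add: norm_shear_dir)
    also have "\<bar>s * ?c\<bar> \<le> 1 * \<bar>?c\<bar>"
      unfolding abs_mult using that by (intro mult_right_mono) auto
    finally show ?thesis using x by simp
  qed
  have e_deriv: "(e has_vector_derivative ?c *\<^sub>R shear_dir i j) (at s within S)" for s S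
    unfolding e_def has_vector_derivative_def
    by (auto intro!: derivative_eq_intros simp: algebra_simps)
  have "Re (e s $ i $ j) = Re (x $ i $ j)" for s by (simp add: e_def)
  then have "\<forall>s\<in>{0..1}. (e has_vector_derivative
      hamiltonian_vector_field omega0 (\<lambda>p. H (s, p)) (e s)) (at s within {0..1})"
    using e_deriv e_norm X by simp
  moreover have "e 0 = x" "x + ?c *\<^sub>R shear_dir i j = e 1" by (simp_all add: e_def)
  ultimately show "\<exists>y. y 0 = x \<and> (\<forall>s\<in>{0..1}. (y has_vector_derivative
      hamiltonian_vector_field omega0 (\<lambda>p. H (s, p)) (y s)) (at s within {0..1})) \<and>
      x + ?c *\<^sub>R shear_dir i j = y 1"
    by (intro exI[of _ e] conjI)
  fix z
  assume "\<exists>y. y 0 = x \<and> (\<forall>s\<in>{0..1}. (y has_vector_derivative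
      hamiltonian_vector_field omega0 (\<lambda>p. H (s, p)) (y s)) (at s within {0..1})) \<and> z = y 1"
  then obtain y where y: "y 0 = x" "z = y 1" and y': "\<And>s. s \<in> {0..1} \<Longrightarrow> (y has_vector_derivative
      hamiltonian_vector_field omega0 (\<lambda>p. H (s, p)) (y s)) (at s within {0..1})"
    by blast
  have y_cont: "continuous_on {0..1} y"
    using y' by (meson continuous_on_eq_continuous_within has_vector_derivative_continuous)
  \<comment> \<open>The bound excludes \<tau> itself, so that the claim applies at the exit time;
    continuity covers this one exceptional point.\<close>
  have agree: "y \<tau> = e \<tau>" if \<tau>: "\<tau> \<in> {0..1}" and stay: "\<And>s. s \<in> {0..<\<tau>} \<Longrightarrow> norm (y s) < K" for \<tau>
  proof -
    have sub: "{0..\<tau>} \<subseteq> {0..1}" using \<tau> by auto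
    have y'': "(y has_vector_derivative f (Re (y s $ i $ j)) *\<^sub>R shear_dir i j) (at s within {0..\<tau>})"
      if "s \<in> {0..\<tau>} - {\<tau>}" for s
    proof -
      have "s \<in> {0..1}" "norm (y s) < K" using that sub stay by auto
      from has_vector_derivative_within_subset[OF y'[OF this(1)] sub] X[OF this]
      show ?thesis by simp
    qed
    have "linear (\<lambda>w::complex^'n^'k. Re (w $ i $ j))"
      by (rule linearI) simp_all
    then have lin: "bounded_linear (\<lambda>w::complex^'n^'k. Re (w $ i $ j))"
      by (simp only: linear_conv_bounded_linear)
    have Re_y: "Re (y s $ i $ j) = Re (x $ i $ j)" if s: "s \<in> {0..\<tau>}" for s
    proof (rule has_derivative_zero_unique_strong_interval[where k="{\<tau>}" and a=0 and b=\<tau>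
          and f="\<lambda>s. Re (y s $ i $ j)"])
      show "continuous_on {0..\<tau>} (\<lambda>s. Re (y s $ i $ j))"
        by (rule bounded_linear.continuous_on[OF lin continuous_on_subset[OF y_cont sub]])
      show "((\<lambda>s. Re (y s $ i $ j)) has_derivative (\<lambda>h. 0)) (at s within {0..\<tau>})" if "s \<in> {0..\<tau>} - {\<tau>}" for s
        using bounded_linear.has_vector_derivative[OF lin y''[OF that]]
        by (simp add: has_vector_derivative_def)
    qed (use y s in auto)
    have "y \<tau> - e \<tau> = 0"
    proof (rule has_derivative_zero_unique_strong_interval[where k="{\<tau>}" and a=0 and b=\<tau>
          and f="\<lambda>s. y s - e s"])
      have "continuous_on {0..\<tau>} e"
        using e_deriv by (meson continuous_on_eq_continuous_within has_vector_derivative_continuous)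
      then show "continuous_on {0..\<tau>} (\<lambda>s. y s - e s)"
        using continuous_on_subset[OF y_cont sub] by (intro continuous_on_diff)
      show "((\<lambda>s. y s - e s) has_derivative (\<lambda>h. 0)) (at s within {0..\<tau>})" if "s \<in> {0..\<tau>} - {\<tau>}" for s
        using has_vector_derivative_diff[OF y''[OF that] e_deriv] Re_y[of s] that
        by (simp add: has_vector_derivative_def)
    qed (use y \<tau> \<open>e 0 = x\<close> in auto)
    then show ?thesis by simp
  qed
  have "norm (y s) < K" if s: "s \<in> {0..1}" for s
  proof (rule ccontr)
    define S where "S = {s \<in> {0..1}. K \<le> norm (y s)}"
    assume "\<not> norm (y s) < K"
    then have "S \<noteq> {}" using s by (auto simp: S_def)
    moreover have "closed S"
      unfolding S_def using y_cont by (intro continuous_on_closed_Collect_le continuous_intros) auto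
    moreover have bdd: "bdd_below S" by (rule bdd_belowI[of _ 0]) (simp add: S_def)
    ultimately have "Inf S \<in> S" using closed_contains_Inf by blast
    then have T: "Inf S \<in> {0..1}" "K \<le> norm (y (Inf S))" by (simp_all add: S_def)
    have "norm (y s) < K" if "s \<in> {0..<Inf S}" for s
    proof -
      have "s \<notin> S" using cInf_lower[OF _ bdd, of s] that by auto
      then show ?thesis using that T(1) by (simp add: S_def)
    qed
    then have "y (Inf S) = e (Inf S)" by (rule agree[OF T(1)])
    then show False using e_norm[OF T(1)] T(2) by simp
  qed
  then have "y 1 = e 1" by (intro agree) auto
  then show "z = x + ?c *\<^sub>R shear_dir i j" using y(2) by (simp add: e_def)
qed

lemma displace_Stiefel:
  fixes C :: real
  assumes "C > pi"
  shows "\<exists>\<phi> \<in> Ham_c (omega0 :: complex^'n^'k \<Rightarrow> complex^'n^'k \<Rightarrow> real).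
    hofer_dist_c omega0 \<phi> id < ereal C \<and> \<phi> ` Stiefel \<inter> Stiefel = {}"
proof -
  fix i :: 'k and j :: 'n
  obtain f f' B M where f: "\<And>n. Ck_on n f UNIV" "\<And>x. 0 \<le> f x" "\<And>x. f x \<le> B" "B < C"
    and f': "\<And>x. (f has_real_derivative f' x) (at x)"
    "\<And>x. \<bar>x\<bar> \<le> 1 \<Longrightarrow> 2 * sqrt (1 - x\<^sup>2) < f' x" "\<And>x. \<bar>x\<bar> \<le> 1 \<Longrightarrow> f' x \<le> M"
    by (rule shear_profile[OF assms]) (rule that)
  \<comment> \<open>Points of the Stiefel manifold have norm \<open>sqrt (CARD('k))\<close> and are
    moved by at most \<open>M\<close>; the summand 1 makes the bound strict.\<close>
  define K where "K = sqrt (CARD('k)) + \<bar>M\<bar> + 1"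
  \<comment> \<open>Using the squared norm keeps the cutoff smooth at 0. It is 1 on the ball of
    radius \<open>K\<close> and has values in [0,1], so it does not enlarge the oscillation
    bound.\<close>
  define cut where "cut = (\<lambda>z::complex^'n^'k. smooth_step (K\<^sup>2 + 1 - z \<bullet> z))"
  define h where "h = (\<lambda>z. f (Re (z $ i $ j)) * cut z)"
  define H where "H = (\<lambda>p::real \<times> (complex^'n^'k). h (snd p))"
  have cut: "0 \<le> cut z" "cut z \<le> 1" for z by (simp_all add: cut_def smooth_step_bounds)
  have h_bounds: "0 \<le> h z" "h z \<le> B" for z
  proof -
    show "0 \<le> h z" unfolding h_def using f cut by (intro mult_nonneg_nonneg)
    have "h z \<le> f (Re (z $ i $ j)) * 1" unfolding h_def using f cut by (intro mult_left_mono)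
    then show "h z \<le> B" using f(3)[of "Re (z $ i $ j)"] by simp
  qed

  have "linear (\<lambda>w::complex^'n^'k. Re (w $ i $ j))"
    by (rule linearI) simp_all
  then have lin: "bounded_linear (\<lambda>w::complex^'n^'k. Re (w $ i $ j))"
    by (simp only: linear_conv_bounded_linear)
  have "Ck_on n H UNIV" for n
  proof -
    have "Ck_on n (\<lambda>p::real \<times> (complex^'n^'k). Re (snd p $ i $ j)) UNIV"
      by (intro Ck_on_linear open_UNIV bounded_linear_compose[OF lin bounded_linear_snd])
    then have 1: "Ck_on n (\<lambda>p::real \<times> (complex^'n^'k). f (Re (snd p $ i $ j))) UNIV"
      by (rule Ck_on_compose_real[OF open_UNIV open_UNIV f(1)]) simp
    have "Ck_on n (\<lambda>p::real \<times> (complex^'n^'k). K\<^sup>2 + 1 - snd p \<bullet> snd p) UNIV"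
      by (intro Ck_on_diff Ck_on_inner Ck_on_const Ck_on_linear bounded_linear_snd open_UNIV)
    then have 2: "Ck_on n (\<lambda>p::real \<times> (complex^'n^'k). smooth_step (K\<^sup>2 + 1 - snd p \<bullet> snd p)) UNIV"
      by (rule Ck_on_compose_real[OF open_UNIV open_UNIV Ck_on_smooth_step]) simp
    show ?thesis
      unfolding H_def h_def cut_def by (rule Ck_on_mult[OF open_UNIV 1 2])
  qed
  then have "smooth_on ({0..1} \<times> UNIV) H" by (rule smooth_onI)
  moreover have "compact (closure {p \<in> {0..1} \<times> UNIV. H p \<noteq> 0})"
  proof -
    have "{p \<in> {0..1} \<times> UNIV. H p \<noteq> 0} \<subseteq> {0..1} \<times> cball 0 (sqrt (K\<^sup>2 + 1))"
    proof
      fix p assume "p \<in> {p \<in> {0..1} \<times> UNIV. H p \<noteq> 0}"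
      then have p: "fst p \<in> {0..1}" "cut (snd p) \<noteq> 0" by (auto simp: H_def h_def)
      from p(2) have "\<not> K\<^sup>2 + 1 - snd p \<bullet> snd p \<le> 0"
        unfolding cut_def by (rule contrapos_nn) (rule smooth_step_eq_0)
      then have "snd p \<bullet> snd p \<le> K\<^sup>2 + 1" by linarith
      then have "norm (snd p) \<le> sqrt (K\<^sup>2 + 1)" by (simp add: norm_eq_sqrt_inner)
      then show "p \<in> {0..1} \<times> cball 0 (sqrt (K\<^sup>2 + 1))" using p by (simp add: mem_Times_iff)
    qed
    then show ?thesis
      unfolding compact_closure
      by (rule bounded_subset[rotated]) (intro bounded_Times bounded_closed_interval bounded_cball)
  qed
  ultimately have H: "H \<in> compactly_supported_hamiltonians"
    by (simp add: compactly_supported_hamiltonians_def)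
  define \<phi> where "\<phi> = hamiltonian_flow omega0 H 1"

  have "hofer_norm H \<le> B"
  proof -
    have "(SUP z. h z) \<le> B" by (rule cSUP_least) (simp_all add: h_bounds)
    moreover have "0 \<le> (INF z. h z)" by (rule cINF_greatest) (simp_all add: h_bounds)
    ultimately have "(SUP z. h z) - (INF z. h z) \<le> B" by linarith
    then show ?thesis by (simp add: hofer_norm_def H_def)
  qed
  then have "ereal (hofer_norm H) < ereal C" using f(4) by simp
  moreover have "hofer_dist_c omega0 \<phi> id \<le> ereal (hofer_norm H)"
    unfolding hofer_dist_c_def \<phi>_def using H by (intro Inf_lower CollectI exI[of _ H]) simp
  ultimately have dist: "hofer_dist_c omega0 \<phi> id < ereal C"
    by (rule order_le_less_trans[rotated])

  have X: "hamiltonian_vector_field omega0 (\<lambda>p. H (s, p)) z = f' (Re (z $ i $ j)) *\<^sub>R shear_dir i j"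
    if "norm z < K" for s z
  proof (rule hamiltonian_vector_field_shear)
    have "((\<lambda>z. f (Re (z $ i $ j))) has_derivative (\<lambda>w. f' (Re (z $ i $ j)) * Re (w $ i $ j))) (at z)"
      by (rule has_derivative_compose[where f="\<lambda>z. Re (z $ i $ j)" and g=f,
            OF bounded_linear_imp_has_derivative[OF lin] f'(1)[unfolded has_field_derivative_def]])
    then show "((\<lambda>p. H (s, p)) has_derivative (\<lambda>w. f' (Re (z $ i $ j)) * Re (w $ i $ j))) (at z)"
    proof (rule has_derivative_transform_within_open[where s="ball 0 K"])
      fix w :: "complex^'n^'k" assume "w \<in> ball 0 K"
      then have "(norm w)\<^sup>2 \<le> K\<^sup>2" by (intro power_mono) auto
      then have "cut w = 1" unfolding cut_def by (intro smooth_step_eq_1) (simp add: power2_norm_eq_inner)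
      then show "f (Re (w $ i $ j)) = H (s, w)" by (simp add: H_def h_def)
    qed (use that in auto)
  qed
  have "\<phi> x \<notin> Stiefel" if x: "x \<in> Stiefel" for x
  proof
    define a b where "a = Re (x $ i $ j)" and "b = Im (x $ i $ j)"
    have ab: "a\<^sup>2 + b\<^sup>2 \<le> 1" using Stiefel_entry[OF x, of i j] by (simp add: a_def b_def)
    have "a\<^sup>2 \<le> 1" using ab zero_le_power2[of b] by linarith
    then have a: "\<bar>a\<bar> \<le> 1" by (simp add: abs_square_le_1)
    have pos: "f' a > 0" using f'(2)[OF a] \<open>a\<^sup>2 \<le> 1\<close> real_sqrt_ge_zero[of "1 - a\<^sup>2"] by linarith
    have \<phi>: "\<phi> x = x + f' a *\<^sub>R shear_dir i j"
      unfolding \<phi>_def a_def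
    proof (rule hamiltonian_flow_shear[where K=K])
      show "norm x + \<bar>f' (Re (x $ i $ j))\<bar> < K"
        using f'(3)[OF a] pos norm_Stiefel[OF x] by (simp add: K_def a_def)
    qed (rule X)
    assume "\<phi> x \<in> Stiefel"
    from Stiefel_entry[OF this, of i j] have ab': "a\<^sup>2 + (b - f' a)\<^sup>2 \<le> 1"
      by (simp add: \<phi> a_def b_def)
    \<comment> \<open>The old and the new entry would lie on the same vertical chord of the unit
      disk, although their distance exceeds its length.\<close>
    have "\<bar>b\<bar> \<le> sqrt (1 - a\<^sup>2)" "\<bar>b - f' a\<bar> \<le> sqrt (1 - a\<^sup>2)"
      using ab ab' by (auto intro!: real_le_rsqrt)
    then show False using f'(2)[OF a] by linarith
  qed
  then have "\<phi> ` Stiefel \<inter> Stiefel = {}" by blast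
  moreover have "\<phi> \<in> Ham_c omega0" using H by (auto simp: Ham_c_def \<phi>_def)
  ultimately show ?thesis using dist by blast
qed

theorem proposition3:
  assumes "CARD('k::finite) \<le> CARD('n::finite)"
  shows "coisotropic_submanifold omega0 (Stiefel :: (complex ^ 'n ^ 'k) set) \<and>
    minimal_area omega0 (Stiefel :: (complex ^ 'n ^ 'k) set) = ereal pi \<and>
    (\<forall>C::real. C > pi \<longrightarrow>
      (\<exists>\<phi> \<in> Ham_c (omega0 :: complex ^ 'n ^ 'k \<Rightarrow> complex ^ 'n ^ 'k \<Rightarrow> real).
         hofer_dist_c omega0 \<phi> id < ereal C \<and> \<phi> ` Stiefel \<inter> Stiefel = {}))"
  by (intro conjI allI impI coisotropic_Stiefel minimal_area_Stiefel[OF assms] displace_Stiefel)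

end
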